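(* Every non-elliptic semigroup of holomorphic self-maps of $\mathbb{D}$ is topologically conjugated to a hyperbolic semigroup of holomorphic self-maps of $\mathbb{D}$.
   Context: $\mathbb{D}$ is the open unit disc in $\mathbb{C}$. A semigroup $(\phi_t)_{t\ge0}$ of holomorphic self-maps of $\mathbb{D}$ is a continuous homomorphism $t\mapsto\phi_t$ from $([0,+\infty),+)$ to the holomorphic self-maps of $\mathbb{D}$ under composition, with the topology of uniform convergence on compacta. It is elliptic if there is a point of $\mathbb{D}$ fixed by all $\phi_t$, and non-elliptic otherwise. If it is non-elliptic there is a unique $x\in\partial\mathbb{D}$ (its Denjoy--Wolff point) with $\lim_{t\to\infty}\phi_t(z)=x$ for all $z\in\mathbb{D}$, and there is $\lambda\le0$ (its dilation) such that $\liminf_{z\to x}\frac{1-|\phi_t(z)|}{1-|z|}=e^{\lambda t}$ for all $t\ge0$; the semigroup is hyperbolic if $\lambda\neq0$ and parabolic if $\lambda=0$. Two semigroups $(\phi_t)$, $(\tilde\phi_t)$ are topologically conjugated if there is a homeomorphism $T:\mathbb{D}\to\mathbb{D}$ with $T\circ\tilde\phi_t\circ T^{-1}=\phi_t$ for all $t\ge0$. *)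

theory Defs
  imports "HOL-Complex_Analysis.Complex_Analysis"
begin

abbreviation unit_disc :: "complex set" (\<open>\<bbbD>\<close>)
  where "\<bbbD> \<equiv> ball 0 1"

text \<open>A family of self-maps of the disc indexed by \<open>t \<ge> 0\<close> is a total function
  \<open>\<phi> :: real \<Rightarrow> complex \<Rightarrow> complex\<close>; its values for \<open>t < 0\<close> or off the disc are junk
  and every notion below ignores them. The homomorphism is one of monoids, that is,
  \<open>\<phi> 0\<close> is the identity of the disc.\<close>

definition holomorphic_semigroup :: "(real \<Rightarrow> complex \<Rightarrow> complex) \<Rightarrow> bool" where
  "holomorphic_semigroup \<phi> \<longleftrightarrow>
     (\<forall>t\<ge>0. \<phi> t holomorphic_on \<bbbD> \<and> \<phi> t ` \<bbbD> \<subseteq> \<bbbD>) \<and>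
     (\<forall>z\<in>\<bbbD>. \<phi> 0 z = z) \<and>
     (\<forall>s\<ge>0. \<forall>t\<ge>0. \<forall>z\<in>\<bbbD>. \<phi> (s + t) z = \<phi> s (\<phi> t z)) \<and>
     (\<forall>t\<ge>0. \<forall>K. compact K \<and> K \<subseteq> \<bbbD> \<longrightarrow> uniform_limit K \<phi> (\<phi> t) (at t within {0..}))"

definition elliptic :: "(real \<Rightarrow> complex \<Rightarrow> complex) \<Rightarrow> bool" where
  "elliptic \<phi> \<longleftrightarrow> (\<exists>z\<in>\<bbbD>. \<forall>t\<ge>0. \<phi> t z = z)"

definition denjoy_wolff_point :: "(real \<Rightarrow> complex \<Rightarrow> complex) \<Rightarrow> complex \<Rightarrow> bool" where
  "denjoy_wolff_point \<phi> x \<longleftrightarrow>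
     x \<in> frontier \<bbbD> \<and> (\<forall>z\<in>\<bbbD>. ((\<lambda>t. \<phi> t z) \<longlongrightarrow> x) at_top)"

text \<open>The Denjoy--Wolff point and the dilation are treated as relations; both are unique
  when they exist. The lower limit is taken in the extended reals, over points of the disc.\<close>

definition dilation :: "(real \<Rightarrow> complex \<Rightarrow> complex) \<Rightarrow> real \<Rightarrow> bool" where
  "dilation \<phi> l \<longleftrightarrow> l \<le> 0 \<and>
     (\<exists>x. denjoy_wolff_point \<phi> x \<and>
        (\<forall>t\<ge>0. Liminf (at x within \<bbbD>) (\<lambda>z. ereal ((1 - norm (\<phi> t z)) / (1 - norm z)))
                = ereal (exp (l * t))))"

definition hyperbolic_semigroup :: "(real \<Rightarrow> complex \<Rightarrow> complex) \<Rightarrow> bool" where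
  "hyperbolic_semigroup \<phi> \<longleftrightarrow>
     holomorphic_semigroup \<phi> \<and> \<not> elliptic \<phi> \<and> (\<exists>l. dilation \<phi> l \<and> l \<noteq> 0)"

definition topologically_conjugated ::
    "(real \<Rightarrow> complex \<Rightarrow> complex) \<Rightarrow> (real \<Rightarrow> complex \<Rightarrow> complex) \<Rightarrow> bool" where
  "topologically_conjugated \<phi> \<psi> \<longleftrightarrow>
     (\<exists>T T'. homeomorphism \<bbbD> \<bbbD> T T' \<and> (\<forall>t\<ge>0. \<forall>z\<in>\<bbbD>. T (\<psi> t (T' z)) = \<phi> t z))"

end

theory Submission
  imports Defs
begin

text \<open>A non-elliptic semigroup has a Koenigs function: a univalent \<open>h\<close> with
  \<open>h (\<phi> t z) = h z + t\<close>. Compressing the plane vertically by a homeomorphism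
  \<open>x + iy \<mapsto> x + i q y\<close>, which commutes with horizontal translations, carries \<open>h \<bbbD>\<close> onto a
  simply connected domain \<open>V\<close> inside a horizontal strip, and pulling the translations of \<open>V\<close>
  back to the disc along a Riemann map gives \<open>\<psi>\<close>. When the strip \<open>\<bar>Im w\<bar> < pi/2\<close> is the
  smallest one containing \<open>V\<close>, comparing \<open>V\<close> with it and with slightly narrower half-strips
  inside \<open>V\<close> shows that orbits of \<open>\<psi>\<close> approach the boundary at the rate \<open>exp (- t)\<close>; together
  with Julia's lemma this forces the dilation to be \<open>-1\<close>.\<close>

subsection \<open>Schwarz--Pick inequalities\<close>

text \<open>The conjugacy is only a homeomorphism, so of the Koenigs domain it has to keep nothing
  but the translations: the imaginary coordinate may be distorted freely, while the conformal
  structure is lost and a new Riemann map has to be taken. Bounded height is what produces a nonzero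
  dilation, and height pi is the normalisation for which \<open>exp\<close> maps the strip onto the
  right half-plane and turns translation by \<open>t\<close> into multiplication by
  \<open>exp t\<close>; hence the value -1. Two obstacles shape the rest. A semigroup is only
  assumed continuous in \<open>t\<close>, so differentiability must be gained before there is a
  generator to integrate. And the dilation is a lower limit over all approaches to the Denjoy-Wolff
  point, whereas the geometry of \<open>V\<close> controls orbits only. One orbit suffices to bound
  this lower limit from above; to bound it from below, Julia's lemma turns a small quotient along an
  arbitrary sequence into a contraction of horodiscs, which iteration then compares with the decay
  of an orbit.\<close>

lemma one_minus_norm_Moebius:
  assumes "norm a < 1" "norm z < 1"
  shows "(1 - (norm (Moebius_function 0 a z))\<^sup>2) * (norm (1 - cnj a * z))\<^sup>2
       = (1 - (norm a)\<^sup>2) * (1 - (norm z)\<^sup>2)"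
proof -
  have "norm (cnj a * z) < 1"
    using assms by (metis complex_mod_cnj mult.left_neutral mult_strict_mono' norm_ge_zero norm_mult)
  then have nz: "1 - cnj a * z \<noteq> 0" by auto
  have "(1 - (norm (Moebius_function 0 a z))\<^sup>2) * (norm (1 - cnj a * z))\<^sup>2
      = (norm (1 - cnj a * z))\<^sup>2 - (norm (z - a))\<^sup>2"
    using nz by (simp add: Moebius_function_simple norm_divide power_divide left_diff_distrib)
  also have "\<dots> = (1 - (norm a)\<^sup>2) * (1 - (norm z)\<^sup>2)"
    by (simp add: cmod_power2) (simp add: power2_eq_square algebra_simps)
  finally show ?thesis .
qed

text \<open>Moebius maps move \<open>a\<close> and \<open>f a\<close> to 0, where Schwarz's lemma
  applies. The form without denominators keeps \<open>1 - |a|^2\<close> as a separate factor, which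
  can be cancelled while \<open>a\<close> tends to the circle.\<close>

theorem Schwarz_Pick:
  assumes "f holomorphic_on \<bbbD>" "f ` \<bbbD> \<subseteq> \<bbbD>" "a \<in> \<bbbD>" "z \<in> \<bbbD>"
  shows "(norm (1 - cnj (f a) * f z))\<^sup>2 * ((1 - (norm a)\<^sup>2) * (1 - (norm z)\<^sup>2))
       \<le> (norm (1 - cnj a * z))\<^sup>2 * ((1 - (norm (f a))\<^sup>2) * (1 - (norm (f z))\<^sup>2))"
proof -
  let ?M = "Moebius_function 0"
  have a: "norm a < 1" "norm (-a) < 1" and z: "norm z < 1" using assms by auto
  have fD: "norm (f w) < 1" if "norm w < 1" for w using assms(2) that by (force simp: image_subset_iff)
  define g where "g = (\<lambda>w. ?M (f a) (f (?M (- a) w)))"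
  have "?M (f a) \<circ> f \<circ> ?M (- a) holomorphic_on \<bbbD>"
    by (intro holomorphic_on_compose_gen[where t=\<bbbD>] Moebius_function_holomorphic assms(1))
       (use fD a Moebius_function_norm_lt_1 assms in auto)
  then have hol: "g holomorphic_on \<bbbD>" by (simp add: g_def o_def)
  have g0: "g 0 = 0" by (simp add: g_def Moebius_function_of_zero Moebius_function_eq_zero)
  have g1: "norm (g w) < 1" if "norm w < 1" for w
    unfolding g_def by (intro Moebius_function_norm_lt_1 fD a that)
  have "norm (g (?M a z)) \<le> norm (?M a z)"
    using Schwarz_Lemma(1)[OF hol g0 g1] Moebius_function_norm_lt_1 a z by blast
  moreover have "g (?M a z) = ?M (f a) (f z)"
    unfolding g_def using Moebius_function_compose[of "-a" a z] a z by simp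
  ultimately have "(norm (?M (f a) (f z)))\<^sup>2 \<le> (norm (?M a z))\<^sup>2"
    by (simp add: power_mono)
  then have "(norm (1 - cnj a * z))\<^sup>2 * (norm (1 - cnj (f a) * f z))\<^sup>2 * (1 - (norm (?M a z))\<^sup>2)
     \<le> (norm (1 - cnj a * z))\<^sup>2 * (norm (1 - cnj (f a) * f z))\<^sup>2 * (1 - (norm (?M (f a) (f z)))\<^sup>2)"
    by (intro mult_left_mono) auto
  then have "(norm (1 - cnj (f a) * f z))\<^sup>2 * ((1 - (norm (?M a z))\<^sup>2) * (norm (1 - cnj a * z))\<^sup>2)
     \<le> (norm (1 - cnj a * z))\<^sup>2 * ((1 - (norm (?M (f a) (f z)))\<^sup>2) * (norm (1 - cnj (f a) * f z))\<^sup>2)"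
    by (simp only: mult_ac)
  then show ?thesis
    unfolding one_minus_norm_Moebius[OF a(1) z] one_minus_norm_Moebius[OF fD[OF a(1)] fD[OF z]] .
qed

text \<open>With \<open>a\<close> moved to 0, the second fixed point gives equality in Schwarz's
  lemma, so the conjugated map is a rotation; fixing a nonzero point, it has factor 1.\<close>

lemma holomorphic_disc_two_fixed_points:
  assumes "f holomorphic_on \<bbbD>" "f ` \<bbbD> \<subseteq> \<bbbD>" "a \<in> \<bbbD>" "b \<in> \<bbbD>" "a \<noteq> b" "f a = a" "f b = b" "z \<in> \<bbbD>"
  shows "f z = z"
proof -
  let ?M = "Moebius_function 0"
  have a: "norm a < 1" "norm (-a) < 1" and b: "norm b < 1" and z: "norm z < 1" using assms by auto
  have fD: "norm (f w) < 1" if "norm w < 1" for w using assms(2) that by (force simp: image_subset_iff)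
  define g where "g = (\<lambda>w. ?M a (f (?M (- a) w)))"
  have "?M a \<circ> f \<circ> ?M (- a) holomorphic_on \<bbbD>"
    by (intro holomorphic_on_compose_gen[where t=\<bbbD>] Moebius_function_holomorphic assms(1))
       (use fD a Moebius_function_norm_lt_1 assms in auto)
  then have hol: "g holomorphic_on \<bbbD>" by (simp add: g_def o_def)
  have g0: "g 0 = 0" by (simp add: g_def Moebius_function_of_zero Moebius_function_eq_zero assms)
  have g1: "norm (g w) < 1" if "norm w < 1" for w
    unfolding g_def by (intro Moebius_function_norm_lt_1 fD a that)
  have inv: "?M (- a) (?M a w) = w" "?M a (?M (- a) w) = w" if "norm w < 1" for w
    using Moebius_function_compose[of "-a" a w] Moebius_function_compose[of a "-a" w] a that by auto
  have gM: "g (?M a w) = ?M a (f w)" if "norm w < 1" for w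
    unfolding g_def by (simp add: inv that)
  have Mb: "?M a b \<noteq> 0" "norm (?M a b) < 1" "g (?M a b) = ?M a b"
    using inv(1)[OF b] assms(5) Moebius_function_norm_lt_1[OF a(1) b] gM[OF b] assms(7)
    by (auto simp: Moebius_function_of_zero)
  obtain c where c: "\<And>w. norm w < 1 \<Longrightarrow> g w = c * w"
  proof -
    have "\<exists>\<alpha>. (\<forall>w. norm w < 1 \<longrightarrow> g w = \<alpha> * w) \<and> norm \<alpha> = 1"
      using Schwarz_Lemma(3)[OF hol g0 g1, of 0] Mb by (metis norm_zero zero_less_one)
    then show ?thesis using that by blast
  qed
  have "c = 1" using c[OF Mb(2)] Mb by auto
  then have "?M a (f z) = ?M a z" using gM[OF z] c[of "?M a z"] Moebius_function_norm_lt_1[OF a(1) z] by simp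
  then show ?thesis by (metis inv(1) fD z)
qed

text \<open>Both ingredients of Schwarz-Pick in half-plane coordinates. The factors
  \<open>norm (w + 1)\<close> and \<open>norm (v + 1)\<close> cancel when they are inserted.\<close>

lemma Cayley_ratio:
  fixes w v :: complex
  assumes "Re w > 0" "Re v > 0"
  defines "c \<equiv> \<lambda>u::complex. (u - 1) / (u + 1)"
  shows "1 - (norm (c w))\<^sup>2 = 4 * Re w / (norm (w + 1))\<^sup>2"
    and "(norm (1 - cnj (c w) * c v))\<^sup>2 = 4 * (norm (cnj w + v))\<^sup>2 / ((norm (w + 1))\<^sup>2 * (norm (v + 1))\<^sup>2)"
proof -
  have nz: "w + 1 \<noteq> 0" "v + 1 \<noteq> 0" "cnj w + 1 \<noteq> 0" using assms
    by (auto simp: complex_eq_iff)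
  show "1 - (norm (c w))\<^sup>2 = 4 * Re w / (norm (w + 1))\<^sup>2"
  proof -
    have "(norm (w + 1))\<^sup>2 - (norm (w - 1))\<^sup>2 = 4 * Re w"
      by (simp add: cmod_power2) (simp add: power2_eq_square algebra_simps)
    then show ?thesis
      using nz unfolding c_def norm_divide power_divide by (simp add: divide_simps)
  qed
  have "1 - cnj (c w) * c v = 2 * (cnj w + v) / ((cnj w + 1) * (v + 1))"
  proof -
    have "1 - cnj (c w) * c v = ((cnj w + 1) * (v + 1) - (cnj w - 1) * (v - 1)) / ((cnj w + 1) * (v + 1))"
      using nz by (simp add: c_def diff_divide_distrib[of "(cnj w + 1) * (v + 1)"])
    then show ?thesis by (simp add: algebra_simps)
  qed
  moreover have "norm (cnj w + 1) = norm (w + 1)" by (metis complex_cnj_add complex_cnj_one complex_mod_cnj)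
  ultimately show "(norm (1 - cnj (c w) * c v))\<^sup>2 = 4 * (norm (cnj w + v))\<^sup>2 / ((norm (w + 1))\<^sup>2 * (norm (v + 1))\<^sup>2)"
    by (simp add: norm_divide norm_mult power_divide power_mult_distrib
        del: complex_cnj_diff complex_cnj_divide distrib_left_numeral)
qed

lemma Cayley_in_disc: "Re w > 0 \<Longrightarrow> norm ((w - 1) / (w + 1)) < 1"
proof -
  assume w: "Re w > 0"
  then have "w + 1 \<noteq> 0" by (auto simp: complex_eq_iff)
  then have "0 < 4 * Re w / (norm (w + 1))\<^sup>2" using w by simp
  then have "(norm ((w - 1) / (w + 1)))\<^sup>2 < 1\<^sup>2" using Cayley_ratio(1)[OF w w] by simp
  then show ?thesis by (rule power_less_imp_less_base) simp
qed

corollary Schwarz_Pick_into_halfplane: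
  assumes F: "F holomorphic_on \<bbbD>" "\<And>z. z \<in> \<bbbD> \<Longrightarrow> Re (F z) > 0" and az: "a \<in> \<bbbD>" "z \<in> \<bbbD>"
  shows "(norm (cnj (F a) + F z))\<^sup>2 * ((1 - (norm a)\<^sup>2) * (1 - (norm z)\<^sup>2))
       \<le> (norm (1 - cnj a * z))\<^sup>2 * (4 * Re (F a) * Re (F z))"
proof -
  define f where "f = (\<lambda>z. (F z - 1) / (F z + 1))"
  have nz: "F z + 1 \<noteq> 0" if "z \<in> \<bbbD>" for z using F(2)[OF that] by (auto simp: complex_eq_iff)
  have "f holomorphic_on \<bbbD>" unfolding f_def using nz by (intro holomorphic_intros F)
  moreover have "f ` \<bbbD> \<subseteq> \<bbbD>" unfolding f_def using Cayley_in_disc F(2) by auto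
  ultimately have "(norm (1 - cnj (f a) * f z))\<^sup>2 * ((1 - (norm a)\<^sup>2) * (1 - (norm z)\<^sup>2))
       \<le> (norm (1 - cnj a * z))\<^sup>2 * ((1 - (norm (f a))\<^sup>2) * (1 - (norm (f z))\<^sup>2))"
    by (rule Schwarz_Pick) fact+
  moreover have "norm (F a + 1) > 0" "norm (F z + 1) > 0" using nz az by auto
  ultimately show ?thesis
    unfolding f_def Cayley_ratio[OF F(2)[OF az(1)] F(2)[OF az(2)]] Cayley_ratio(1)[OF F(2)[OF az(2)] F(2)[OF az(2)]]
    by (simp add: divide_simps mult_ac)
qed

corollary Schwarz_Pick_from_halfplane:
  assumes f: "f holomorphic_on {w. Re w > 0}" "\<And>w. Re w > 0 \<Longrightarrow> f w \<in> \<bbbD>" and wv: "Re w > 0" "Re v > 0"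
  shows "(norm (1 - cnj (f w) * f v))\<^sup>2 * (4 * Re w * Re v)
       \<le> (norm (cnj w + v))\<^sup>2 * ((1 - (norm (f w))\<^sup>2) * (1 - (norm (f v))\<^sup>2))"
proof -
  define b where "b = (\<lambda>z::complex. (1 + z) / (1 - z))"
  define c where "c = (\<lambda>u::complex. (u - 1) / (u + 1))"
  have nz: "1 - z \<noteq> 0" if "z \<in> \<bbbD>" for z :: complex using that by auto
  have bH: "Re (b z) > 0" if "z \<in> \<bbbD>" for z
  proof -
    have "Re (b z) = (1 - (norm z)\<^sup>2) / (norm (1 - z))\<^sup>2"
      unfolding b_def by (simp add: Re_divide cmod_power2) (simp add: power2_eq_square algebra_simps)
    moreover have "(norm z)\<^sup>2 < 1" using that by (simp add: abs_square_less_1)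
    ultimately show ?thesis using nz[OF that] by simp
  qed
  have bc: "b (c u) = u" "c u \<in> \<bbbD>" if "Re u > 0" for u
  proof -
    have "u + 1 \<noteq> 0" using that by (auto simp: complex_eq_iff)
    then have "1 + c u = 2 * u / (u + 1)" "1 - c u = 2 / (u + 1)"
      by (simp_all add: c_def divide_simps)
    with \<open>u + 1 \<noteq> 0\<close> show "b (c u) = u" by (simp add: b_def)
    show "c u \<in> \<bbbD>" using Cayley_in_disc[OF that] by (simp add: c_def)
  qed
  have "b holomorphic_on \<bbbD>" unfolding b_def using nz by (intro holomorphic_intros) auto
  then have "f \<circ> b holomorphic_on \<bbbD>"
    using bH by (intro holomorphic_on_compose_gen[OF _ f(1)]) auto
  moreover have "(f \<circ> b) ` \<bbbD> \<subseteq> \<bbbD>" using bH f(2) by auto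
  ultimately have "(norm (1 - cnj (f w) * f v))\<^sup>2 * ((1 - (norm (c w))\<^sup>2) * (1 - (norm (c v))\<^sup>2))
       \<le> (norm (1 - cnj (c w) * c v))\<^sup>2 * ((1 - (norm (f w))\<^sup>2) * (1 - (norm (f v))\<^sup>2))"
    using Schwarz_Pick[of "f \<circ> b" "c w" "c v"] bc wv by simp
  moreover have "norm (w + 1) > 0" "norm (v + 1) > 0" using wv by (auto simp: complex_eq_iff)
  ultimately show ?thesis
    unfolding c_def Cayley_ratio[OF wv] Cayley_ratio(1)[OF wv(2) wv(2)] by (simp add: divide_simps mult_ac)
qed

subsection \<open>Horodiscs and the Wolff point\<close>

text \<open>For \<open>norm \<tau> = 1\<close> the sublevel sets of \<open>horo \<tau>\<close> are the horodiscs at \<open>\<tau>\<close>.\<close>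

definition horo :: "complex \<Rightarrow> complex \<Rightarrow> real" where
  "horo \<tau> z = (norm (\<tau> - z))\<^sup>2 / (1 - (norm z)\<^sup>2)"

lemma one_minus_norm_sq_pos: "z \<in> \<bbbD> \<Longrightarrow> 1 - (norm z)\<^sup>2 > 0"
  by (simp add: abs_square_less_1)

lemma norm_one_minus_cnj:
  assumes "norm \<tau> = 1"
  shows "norm (1 - cnj \<tau> * z) = norm (\<tau> - z)"
proof -
  have "cnj \<tau> * \<tau> = 1" using assms by (metis complex_norm_square mult.commute of_real_1 one_power2)
  then have "1 - cnj \<tau> * z = cnj \<tau> * (\<tau> - z)" by (simp add: algebra_simps)
  then show ?thesis by (simp add: norm_mult assms)
qed

lemma horo_pos: "norm \<tau> = 1 \<Longrightarrow> z \<in> \<bbbD> \<Longrightarrow> horo \<tau> z > 0"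
  using one_minus_norm_sq_pos[of z] unfolding horo_def by (intro divide_pos_pos) auto

text \<open>Schwarz-Pick at \<open>a n\<close>, divided by \<open>1 - |a n|^2\<close>, has two
  convergent sides. Maps and factors may vary with \<open>n\<close>, so the same limit serves
  approximating maps at their fixed points (Wolff) and one map along a sequence of small quotients
  (dilation).\<close>

lemma Julia_limit:
  fixes f :: "nat \<Rightarrow> complex \<Rightarrow> complex"
  assumes f: "\<And>n. f n holomorphic_on \<bbbD>" "\<And>n. f n ` \<bbbD> \<subseteq> \<bbbD>"
    and a: "\<And>n. a n \<in> \<bbbD>"
    and c: "\<And>n. 1 - (norm (f n (a n)))\<^sup>2 \<le> c n * (1 - (norm (a n))\<^sup>2)"
    and lim: "a \<longlonglongrightarrow> \<tau>" "(\<lambda>n. f n (a n)) \<longlonglongrightarrow> y" "c \<longlonglongrightarrow> C" "(\<lambda>n. f n z) \<longlonglongrightarrow> w"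
    and norms: "norm \<tau> = 1" "norm y = 1" and zw: "z \<in> \<bbbD>" "w \<in> \<bbbD>"
  shows "horo y w \<le> C * horo \<tau> z"
proof -
  have "(norm (1 - cnj (f n (a n)) * f n z))\<^sup>2 * (1 - (norm z)\<^sup>2)
      \<le> c n * (norm (1 - cnj (a n) * z))\<^sup>2 * (1 - (norm (f n z))\<^sup>2)" for n
  proof -
    have fz: "1 - (norm (f n z))\<^sup>2 > 0" using f(2)[of n] zw by (intro one_minus_norm_sq_pos) blast
    have "(norm (1 - cnj (f n (a n)) * f n z))\<^sup>2 * ((1 - (norm (a n))\<^sup>2) * (1 - (norm z)\<^sup>2))
       \<le> (norm (1 - cnj (a n) * z))\<^sup>2 * ((1 - (norm (f n (a n)))\<^sup>2) * (1 - (norm (f n z))\<^sup>2))"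
      by (rule Schwarz_Pick) (use f a zw in auto)
    also have "\<dots> \<le> (norm (1 - cnj (a n) * z))\<^sup>2 * ((c n * (1 - (norm (a n))\<^sup>2)) * (1 - (norm (f n z))\<^sup>2))"
      using c[of n] fz by (intro mult_left_mono mult_right_mono) auto
    finally have "(1 - (norm (a n))\<^sup>2) * ((norm (1 - cnj (f n (a n)) * f n z))\<^sup>2 * (1 - (norm z)\<^sup>2))
       \<le> (1 - (norm (a n))\<^sup>2) * (c n * (norm (1 - cnj (a n) * z))\<^sup>2 * (1 - (norm (f n z))\<^sup>2))"
      by (simp only: mult_ac)
    then show ?thesis
      using one_minus_norm_sq_pos[OF a[of n]] by (simp only: mult_le_cancel_left_pos)
  qed
  moreover have "(\<lambda>n. (norm (1 - cnj (f n (a n)) * f n z))\<^sup>2 * (1 - (norm z)\<^sup>2))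
      \<longlonglongrightarrow> (norm (1 - cnj y * w))\<^sup>2 * (1 - (norm z)\<^sup>2)"
    by (intro tendsto_intros lim)
  moreover have "(\<lambda>n. c n * (norm (1 - cnj (a n) * z))\<^sup>2 * (1 - (norm (f n z))\<^sup>2))
      \<longlonglongrightarrow> C * (norm (1 - cnj \<tau> * z))\<^sup>2 * (1 - (norm w)\<^sup>2)"
    by (intro tendsto_intros lim)
  ultimately have "(norm (1 - cnj y * w))\<^sup>2 * (1 - (norm z)\<^sup>2) \<le> C * (norm (1 - cnj \<tau> * z))\<^sup>2 * (1 - (norm w)\<^sup>2)"
    by (intro LIMSEQ_le) auto
  then show ?thesis
    using one_minus_norm_sq_pos[OF zw(1)] one_minus_norm_sq_pos[OF zw(2)]
    unfolding horo_def norm_one_minus_cnj[OF norms(1)] norm_one_minus_cnj[OF norms(2)]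
    by (simp add: field_simps)
qed

text \<open>The shrunk maps \<open>r n * f\<close> have fixed points by Brouwer. A limit of these
  inside the disc would be fixed by \<open>f\<close>, so they accumulate on the circle, and Julia's
  lemma with factor 1 applies there.\<close>

theorem Wolff:
  assumes f: "f holomorphic_on \<bbbD>" "f ` \<bbbD> \<subseteq> \<bbbD>" and nofix: "\<And>z. z \<in> \<bbbD> \<Longrightarrow> f z \<noteq> z"
  obtains \<tau> where "norm \<tau> = 1" "\<And>z. z \<in> \<bbbD> \<Longrightarrow> horo \<tau> (f z) \<le> horo \<tau> z"
proof -
  \<comment> \<open>The offset 2 makes \<open>r 0\<close> positive.\<close>
  define r where "r n = 1 - 1 / real (n + 2)" for n
  have r: "0 < r n" "r n < 1" for n by (auto simp: r_def)
  have rlim: "r \<longlonglongrightarrow> 1"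
  proof -
    have "(\<lambda>n. 1 - 1 / real (n + 2)) \<longlonglongrightarrow> 1 - 0"
      by (intro tendsto_intros LIMSEQ_ignore_initial_segment[of "\<lambda>n. 1 / real n"] lim_1_over_n)
    then show ?thesis by (simp add: r_def[abs_def])
  qed
  define g where "g n z = of_real (r n) * f z" for n z
  have gn: "norm (g n z) < r n" if "z \<in> \<bbbD>" for n z
    using f(2) that r[of n] by (auto simp: g_def norm_mult image_subset_iff)
  have ghol: "g n holomorphic_on \<bbbD>" for n unfolding g_def by (intro holomorphic_intros f)
  have "\<exists>z\<in>cball 0 (r n). g n z = z" for n
  proof -
    have "cball 0 (r n) \<subseteq> \<bbbD>" using r[of n] by auto
    then have "continuous_on (cball 0 (r n)) (g n)" "g n \<in> cball 0 (r n) \<rightarrow> cball 0 (r n)"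
      using ghol[of n] gn[of _ n] by (auto simp: Pi_iff subset_iff less_imp_le intro!: holomorphic_on_imp_continuous_on elim: holomorphic_on_subset)
    then show ?thesis
      using r[of n] brouwer[of "cball 0 (r n)" "g n"] by (metis compact_cball convex_cball cball_eq_empty less_imp_le not_le)
  qed
  then obtain a where a: "\<And>n. a n \<in> cball 0 (r n)" "\<And>n. g n (a n) = a n" by metis
  have aD: "a n \<in> \<bbbD>" for n using a(1)[of n] r[of n] by auto
  have "a n \<in> cball 0 1" for n using aD[of n] by auto
  then obtain \<tau> \<sigma> where \<tau>: "\<tau> \<in> cball 0 1" and \<sigma>: "strict_mono \<sigma>" and lim: "(a \<circ> \<sigma>) \<longlonglongrightarrow> \<tau>"
    using compact_cball[of "0::complex" 1] unfolding compact_def by metis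
  have rs: "(r \<circ> \<sigma>) \<longlonglongrightarrow> 1" using LIMSEQ_subseq_LIMSEQ[OF rlim \<sigma>] .
  have "norm \<tau> = 1"
  proof (rule ccontr)
    assume "norm \<tau> \<noteq> 1"
    then have D: "\<tau> \<in> \<bbbD>" using \<tau> by auto
    then have "isCont f \<tau>" using f(1) by (simp add: holomorphic_on_imp_differentiable_at field_differentiable_imp_continuous_at)
    then have "(\<lambda>n. f ((a \<circ> \<sigma>) n)) \<longlonglongrightarrow> f \<tau>" using lim by (rule isCont_tendsto_compose)
    then have "(\<lambda>n. of_real ((r \<circ> \<sigma>) n) * f ((a \<circ> \<sigma>) n)) \<longlonglongrightarrow> of_real 1 * f \<tau>"
      by (intro tendsto_mult tendsto_of_real rs)
    moreover have "(\<lambda>n. of_real ((r \<circ> \<sigma>) n) * f ((a \<circ> \<sigma>) n)) = a \<circ> \<sigma>"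
      using a(2) by (auto simp: g_def)
    ultimately have "f \<tau> = \<tau>" using lim LIMSEQ_unique by fastforce
    then show False using nofix D by blast
  qed
  moreover have "horo \<tau> (f z) \<le> 1 * horo \<tau> z" if "z \<in> \<bbbD>" for z
  proof (rule Julia_limit[where f="g \<circ> \<sigma>" and a="a \<circ> \<sigma>" and c="\<lambda>_. 1"])
    have "(\<lambda>n. of_real ((r \<circ> \<sigma>) n) * f z) \<longlonglongrightarrow> of_real 1 * f z"
      by (intro tendsto_intros rs)
    then show "(\<lambda>n. (g \<circ> \<sigma>) n z) \<longlonglongrightarrow> f z" by (simp add: g_def)
    show "(g \<circ> \<sigma>) n ` \<bbbD> \<subseteq> \<bbbD>" for n using gn[of _ "\<sigma> n"] r[of "\<sigma> n"] by fastforce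
    show "f z \<in> \<bbbD>" using f(2) that by blast
    show "(\<lambda>n. (g \<circ> \<sigma>) n ((a \<circ> \<sigma>) n)) \<longlonglongrightarrow> \<tau>" using lim by (simp add: a(2) o_def)
  qed (use ghol aD lim that a(2) \<open>norm \<tau> = 1\<close> in auto)
  ultimately show ?thesis using that by simp
qed

section \<open>Dyadic times and a common Wolff point for the semigroup\<close>

lemma semigroupD:
  assumes "holomorphic_semigroup \<phi>"
  shows "t \<ge> 0 \<Longrightarrow> \<phi> t holomorphic_on \<bbbD>"
    and "t \<ge> 0 \<Longrightarrow> z \<in> \<bbbD> \<Longrightarrow> \<phi> t z \<in> \<bbbD>"
    and "z \<in> \<bbbD> \<Longrightarrow> \<phi> 0 z = z"
    and "s \<ge> 0 \<Longrightarrow> t \<ge> 0 \<Longrightarrow> z \<in> \<bbbD> \<Longrightarrow> \<phi> (s + t) z = \<phi> s (\<phi> t z)"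
    and "t \<ge> 0 \<Longrightarrow> compact K \<Longrightarrow> K \<subseteq> \<bbbD> \<Longrightarrow> uniform_limit K \<phi> (\<phi> t) (at t within {0..})"
  using assms unfolding holomorphic_semigroup_def by blast+

lemma semigroup_continuous_on:
  assumes "holomorphic_semigroup \<phi>" "z \<in> \<bbbD>"
  shows "continuous_on {0..} (\<lambda>t. \<phi> t z)"
  unfolding continuous_on_def
  using tendsto_uniform_limitI[OF semigroupD(5)[OF assms(1), of _ "{z}"], of _ z] assms(2) by auto

lemma semigroup_multiple_fixed:
  assumes "holomorphic_semigroup \<phi>" "z \<in> \<bbbD>" "s \<ge> 0" "\<phi> s z = z"
  shows "\<phi> (real k * s) z = z"
proof (induction k)
  case (Suc k)
  then show ?case
    using semigroupD(4)[OF assms(1), of s "real k * s" z] assms by (simp add: algebra_simps)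
qed (use semigroupD(3) assms in simp)

text \<open>Multiples of \<open>1 / 2 ^ n\<close> are reached by iterating the single map
  \<open>\<phi> (1 / 2 ^ n)\<close>; rounding down to them lets facts about these maps pass to every
  time by continuity.\<close>

lemma dyadic_approximation:
  assumes "t \<ge> 0"
  shows "(\<lambda>n. real (nat \<lfloor>t * 2 ^ n\<rfloor>) * (1 / 2 ^ n)) \<longlonglongrightarrow> t"
proof (rule tendsto_sandwich)
  show "\<forall>\<^sub>F n in sequentially. t - (1/2) ^ n \<le> real (nat \<lfloor>t * 2 ^ n\<rfloor>) * (1 / 2 ^ n)"
  proof (intro always_eventually allI)
    fix n
    have "t * 2 ^ n - 1 \<le> real (nat \<lfloor>t * 2 ^ n\<rfloor>)" using assms by linarith
    then have "(t * 2 ^ n - 1) * (1 / 2 ^ n) \<le> real (nat \<lfloor>t * 2 ^ n\<rfloor>) * (1 / 2 ^ n)"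
      by (rule mult_right_mono) simp
    then show "t - (1/2) ^ n \<le> real (nat \<lfloor>t * 2 ^ n\<rfloor>) * (1 / 2 ^ n)"
      by (simp add: power_divide field_simps)
  qed
  show "\<forall>\<^sub>F n in sequentially. real (nat \<lfloor>t * 2 ^ n\<rfloor>) * (1 / 2 ^ n) \<le> t"
  proof (intro always_eventually allI)
    fix n
    have "real (nat \<lfloor>t * 2 ^ n\<rfloor>) \<le> t * 2 ^ n" using assms by (simp add: of_nat_nat)
    then show "real (nat \<lfloor>t * 2 ^ n\<rfloor>) * (1 / 2 ^ n) \<le> t" by (simp add: field_simps)
  qed
  have "(\<lambda>n. t - (1/2) ^ n) \<longlonglongrightarrow> t - 0"
    by (intro tendsto_intros LIMSEQ_realpow_zero) auto
  then show "(\<lambda>n. t - (1/2) ^ n) \<longlonglongrightarrow> t" by simp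
qed auto

lemma semigroup_tendsto_dyadic:
  assumes "holomorphic_semigroup \<phi>" "z \<in> \<bbbD>" "t \<ge> 0"
  shows "(\<lambda>n. \<phi> (real (nat \<lfloor>t * 2 ^ n\<rfloor>) * (1 / 2 ^ n)) z) \<longlonglongrightarrow> \<phi> t z"
  using continuous_on_tendsto_compose[OF semigroup_continuous_on[OF assms(1,2)] dyadic_approximation[OF assms(3)]]
    assms(3) by auto

lemma elliptic_if_dyadic_fixed:
  assumes \<phi>: "holomorphic_semigroup \<phi>" and p: "p \<in> \<bbbD>" "\<And>n. n \<ge> N \<Longrightarrow> \<phi> (1 / 2 ^ n) p = p"
  shows "elliptic \<phi>"
proof -
  have "\<phi> t p = p" if t: "t \<ge> 0" for t
  proof (rule LIMSEQ_unique[OF semigroup_tendsto_dyadic[OF \<phi> p(1) t]])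
    have "\<phi> (real (nat \<lfloor>t * 2 ^ n\<rfloor>) * (1 / 2 ^ n)) p = p" if "n \<ge> N" for n
      by (rule semigroup_multiple_fixed[OF \<phi> p(1)]) (use p(2) that in auto)
    then show "(\<lambda>n. \<phi> (real (nat \<lfloor>t * 2 ^ n\<rfloor>) * (1 / 2 ^ n)) p) \<longlonglongrightarrow> p"
      by (intro tendsto_eventually eventually_sequentiallyI[of N]) auto
  qed
  then show ?thesis using p(1) unfolding elliptic_def by blast
qed

text \<open>Non-ellipticity excludes only a common fixed point. But fixed points are inherited by
  coarser dyadic times, so if arbitrarily fine dyadic maps had one, all would, and uniqueness for
  maps other than the identity would make these points agree from some level on.\<close>

lemma nonelliptic_dyadic_no_fixed_point:
  assumes \<phi>: "holomorphic_semigroup \<phi>" and ne: "\<not> elliptic \<phi>"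
  obtains N where "\<And>n z. n \<ge> N \<Longrightarrow> z \<in> \<bbbD> \<Longrightarrow> \<phi> (1 / 2 ^ n) z \<noteq> z"
proof (rule ccontr)
  assume "\<not> thesis"
  then have *: "\<exists>n\<ge>N. \<exists>z\<in>\<bbbD>. \<phi> (1 / 2 ^ n) z = z" for N using that by metis
  have down: "\<phi> (1 / 2 ^ m) z = z" if "m \<le> n" "z \<in> \<bbbD>" "\<phi> (1 / 2 ^ n) z = z" for m n z
  proof -
    have "real (2 ^ (n - m)) * (1 / 2 ^ n) = 1 / 2 ^ m"
      using that(1) by (simp add: field_simps flip: power_add)
    then show ?thesis using semigroup_multiple_fixed[OF \<phi> that(2) _ that(3), of "2 ^ (n - m)"] by simp
  qed
  have "\<exists>z\<in>\<bbbD>. \<phi> (1 / 2 ^ n) z = z" for n using *[of n] down by blast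
  then obtain p where p: "\<And>n. p n \<in> \<bbbD>" "\<And>n. \<phi> (1 / 2 ^ n) (p n) = p n" by metis
  show False
  \<comment> \<open>The point 0 tests for the identity: either it is itself the common fixed point,
    or some \<open>\<phi> (1 / 2 ^ N)\<close> moves it and so has at most one fixed point.\<close>
  proof (cases "\<forall>n. \<phi> (1 / 2 ^ n) 0 = 0")
    case True
    then show False using elliptic_if_dyadic_fixed[OF \<phi>, of 0] ne by auto
  next
    case False
    then obtain N where N: "\<phi> (1 / 2 ^ N) 0 \<noteq> 0" by blast
    have "p n = p N" if "n \<ge> N" for n
    proof (rule ccontr)
      assume "p n \<noteq> p N"
      then have "\<phi> (1 / 2 ^ N) 0 = 0"
        using holomorphic_disc_two_fixed_points[of "\<phi> (1 / 2 ^ N)" "p n" "p N" 0]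
          semigroupD[OF \<phi>] p down[OF that p(1) p(2)] by (auto simp: image_subset_iff)
      then show False using N by simp
    qed
    then show False using elliptic_if_dyadic_fixed[OF \<phi> p(1)[of N], of N] p ne by metis
  qed
qed

text \<open>The Wolff points of the dyadic maps might differ. A subsequential limit serves all
  times, since finer and finer steps approximate every \<open>t\<close> and \<open>horo\<close> is
  continuous in both arguments.\<close>

theorem semigroup_Wolff:
  assumes \<phi>: "holomorphic_semigroup \<phi>" and ne: "\<not> elliptic \<phi>"
  obtains \<tau> where "norm \<tau> = 1" "\<And>t z. t \<ge> 0 \<Longrightarrow> z \<in> \<bbbD> \<Longrightarrow> horo \<tau> (\<phi> t z) \<le> horo \<tau> z"
proof -
  obtain N where N: "\<And>n z. n \<ge> N \<Longrightarrow> z \<in> \<bbbD> \<Longrightarrow> \<phi> (1 / 2 ^ n) z \<noteq> z"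
    using nonelliptic_dyadic_no_fixed_point[OF assms] by blast
  have "\<exists>\<tau>. norm \<tau> = 1 \<and> (\<forall>z\<in>\<bbbD>. horo \<tau> (\<phi> (1 / 2 ^ (n + N)) z) \<le> horo \<tau> z)" for n
    by (rule Wolff[of "\<phi> (1 / 2 ^ (n + N))"]) (use semigroupD[OF \<phi>] N[of "n + N"] in auto)
  then obtain \<tau> where \<tau>: "\<And>n. norm (\<tau> n) = 1"
    "\<And>n z. z \<in> \<bbbD> \<Longrightarrow> horo (\<tau> n) (\<phi> (1 / 2 ^ (n + N)) z) \<le> horo (\<tau> n) z" by metis
  have iter: "horo (\<tau> n) (\<phi> (real k * (1 / 2 ^ (n + N))) z) \<le> horo (\<tau> n) z" if "z \<in> \<bbbD>" for n k z
  proof (induction k)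
    case (Suc k)
    have "horo (\<tau> n) (\<phi> (real (Suc k) * (1 / 2 ^ (n + N))) z)
        = horo (\<tau> n) (\<phi> (1 / 2 ^ (n + N)) (\<phi> (real k * (1 / 2 ^ (n + N))) z))"
      using semigroupD(4)[OF \<phi>, of "1 / 2 ^ (n + N)" "real k * (1 / 2 ^ (n + N))" z] that
      by (simp add: algebra_simps add_divide_distrib)
    also have "\<dots> \<le> horo (\<tau> n) (\<phi> (real k * (1 / 2 ^ (n + N))) z)"
      using \<tau>(2) semigroupD(2)[OF \<phi> _ that] by simp
    finally show ?case using Suc by linarith
  qed (use semigroupD(3)[OF \<phi>] that in simp)
  have "\<tau> n \<in> sphere 0 1" for n using \<tau>(1) by auto
  then obtain l \<sigma> where l: "l \<in> sphere 0 1" and \<sigma>: "strict_mono \<sigma>" and lim: "(\<tau> \<circ> \<sigma>) \<longlonglongrightarrow> l"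
    using compact_sphere[of "0::complex" 1] unfolding compact_def by metis
  have "horo l (\<phi> t z) \<le> horo l z" if t: "t \<ge> 0" and z: "z \<in> \<bbbD>" for t z
  proof (rule tendsto_le[OF sequentially_bot])
    have nz: "1 - (norm z)\<^sup>2 \<noteq> 0" "1 - (norm (\<phi> t z))\<^sup>2 \<noteq> 0"
      using one_minus_norm_sq_pos z semigroupD(2)[OF \<phi> t z] by (metis less_irrefl)+
    show "(\<lambda>n. horo ((\<tau> \<circ> \<sigma>) n) z) \<longlonglongrightarrow> horo l z"
      unfolding horo_def by (intro tendsto_intros lim nz)
    \<comment> \<open>Rounding happens at the level of \<open>\<tau> (\<sigma> n)\<close>, so that
      \<open>s n\<close> is a multiple of the step to which this Wolff point belongs.\<close>
    define s where "s n = real (nat \<lfloor>t * 2 ^ (\<sigma> n + N)\<rfloor>) * (1 / 2 ^ (\<sigma> n + N))" for n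
    have "strict_mono (\<lambda>n. \<sigma> n + N)" using \<sigma> by (simp add: strict_mono_def)
    from LIMSEQ_subseq_LIMSEQ[OF semigroup_tendsto_dyadic[OF \<phi> z t] this]
    have "(\<lambda>n. \<phi> (s n) z) \<longlonglongrightarrow> \<phi> t z" by (simp add: o_def s_def)
    then show "(\<lambda>n. horo ((\<tau> \<circ> \<sigma>) n) (\<phi> (s n) z)) \<longlonglongrightarrow> horo l (\<phi> t z)"
      unfolding horo_def by (intro tendsto_intros lim nz)
    show "\<forall>\<^sub>F n in sequentially. horo ((\<tau> \<circ> \<sigma>) n) (\<phi> (s n) z) \<le> horo ((\<tau> \<circ> \<sigma>) n) z"
      using iter[OF z] by (auto simp: s_def)
  qed
  then show ?thesis using that l by auto
qed

subsection \<open>The infinitesimal generator\<close>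

text \<open>Cauchy's inequality turns uniform closeness of \<open>\<phi> s\<close> and
  \<open>\<phi> s0\<close> on a disc into closeness of their derivatives on a smaller one. Joint
  continuity is what differentiation under the integral sign demands later.\<close>

lemma semigroup_deriv_continuous:
  assumes \<phi>: "holomorphic_semigroup \<phi>"
  shows "continuous_on (\<bbbD> \<times> {0..}) (\<lambda>(z, s). deriv (\<phi> s) z)"
proof -
  have "((\<lambda>(z, s). deriv (\<phi> s) z) \<longlongrightarrow> deriv (\<phi> s0) z0) (at (z0, s0) within \<bbbD> \<times> {0..})"
    if z0: "z0 \<in> \<bbbD>" and s0: "s0 \<in> {0..}" for z0 s0
  proof (rule tendstoI)
    fix e :: real assume e: "e > 0"
    \<comment> \<open>A third of the distance to the circle: a disc of radius \<open>r\<close> about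
      a point within \<open>r\<close> of \<open>z0\<close> stays in \<open>cball z0 (2 * r)\<close>,
      which still lies in the open unit disc.\<close>
    define r where "r = (1 - norm z0) / 3"
    have r: "r > 0" using z0 by (simp add: r_def)
    have K: "cball z0 (2 * r) \<subseteq> \<bbbD>"
    proof
      fix w assume "w \<in> cball z0 (2 * r)"
      then have "norm w \<le> norm z0 + 2 * r" using norm_triangle_sub[of w z0] by (simp add: dist_norm norm_minus_commute)
      also have "\<dots> < 1" using z0 by (simp add: r_def field_simps)
      finally show "w \<in> \<bbbD>" by simp
    qed
    have "\<forall>\<^sub>F s in at s0 within {0..}. \<forall>w\<in>cball z0 (2 * r). dist (\<phi> s w) (\<phi> s0 w) < e / 2 * r"
      using semigroupD(5)[OF \<phi> _ _ K, of s0] s0 e r by (intro uniform_limitD) auto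
    then have ev1: "\<forall>\<^sub>F s in nhds s0. s \<in> {0..} \<longrightarrow> (\<forall>w\<in>cball z0 (2 * r). dist (\<phi> s w) (\<phi> s0 w) < e / 2 * r)"
      unfolding eventually_at_filter by (rule eventually_mono) (use e r in \<open>auto split: if_splits\<close>)
    have "continuous_on \<bbbD> (deriv (\<phi> s0))"
      using semigroupD(1)[OF \<phi>] s0 by (intro holomorphic_on_imp_continuous_on holomorphic_deriv) auto
    then have "(deriv (\<phi> s0) \<longlongrightarrow> deriv (\<phi> s0) z0) (nhds z0)"
      using z0 by (metis continuous_on_eq_continuous_at isCont_def open_ball tendsto_at_iff_tendsto_nhds)
    then have "\<forall>\<^sub>F z in nhds z0. dist (deriv (\<phi> s0) z) (deriv (\<phi> s0) z0) < e / 2"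
      using e by (intro tendstoD) auto
    moreover have "\<forall>\<^sub>F z in nhds z0. dist z z0 < r" using r by (metis eventually_nhds_metric)
    ultimately have ev2: "\<forall>\<^sub>F z in nhds z0. dist z z0 < r \<and> dist (deriv (\<phi> s0) z) (deriv (\<phi> s0) z0) < e / 2"
      by eventually_elim auto
    have key: "dist (deriv (\<phi> s) z) (deriv (\<phi> s0) z0) < e"
      if z: "dist z z0 < r" "dist (deriv (\<phi> s0) z) (deriv (\<phi> s0) z0) < e / 2"
        and s: "\<forall>w\<in>cball z0 (2 * r). dist (\<phi> s w) (\<phi> s0 w) < e / 2 * r"
        and s0': "s \<in> {0..}" for z s
    proof -
      have sub: "cball z r \<subseteq> cball z0 (2 * r)"
      proof
        fix x assume "x \<in> cball z r"
        then show "x \<in> cball z0 (2 * r)"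
          using z(1) dist_triangle[of z0 x z] by (simp add: dist_commute)
      qed
      have hol: "\<phi> s holomorphic_on \<bbbD>" "\<phi> s0 holomorphic_on \<bbbD>" using semigroupD(1)[OF \<phi>] s0 s0' by auto
      define d where "d = (\<lambda>w. \<phi> s w - \<phi> s0 w)"
      have dh: "d holomorphic_on \<bbbD>" unfolding d_def by (intro holomorphic_intros hol)
      have zD: "cball z r \<subseteq> \<bbbD>" using sub K by blast
      have "norm ((deriv ^^ 1) d z) \<le> fact 1 * (e / 2 * r) / r ^ 1"
      proof (rule Cauchy_inequality)
        show "d holomorphic_on ball z r" using dh zD by (meson ball_subset_cball holomorphic_on_subset order_trans)
        show "continuous_on (cball z r) d" using dh zD by (meson holomorphic_on_imp_continuous_on holomorphic_on_subset)
        fix x assume "norm (z - x) = r"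
        then have "x \<in> cball z0 (2 * r)" using sub by (auto simp: dist_norm)
        then show "norm (d x) \<le> e / 2 * r" using s s0' by (auto simp: d_def dist_norm less_imp_le)
      qed (rule r)
      then have "norm (deriv d z) \<le> e / 2" using r by simp
      moreover have "deriv d z = deriv (\<phi> s) z - deriv (\<phi> s0) z"
      proof -
        have "z \<in> \<bbbD>" using zD r by (meson centre_in_cball less_imp_le subsetD)
        then have "\<phi> s field_differentiable at z" "\<phi> s0 field_differentiable at z"
          using hol by (auto intro: holomorphic_on_imp_differentiable_at)
        then show ?thesis unfolding d_def by simp
      qed
      ultimately have "dist (deriv (\<phi> s) z) (deriv (\<phi> s0) z) \<le> e / 2" by (simp add: dist_norm)
      then show ?thesis
        using z(2) dist_triangle[of "deriv (\<phi> s) z" "deriv (\<phi> s0) z0" "deriv (\<phi> s0) z"] by linarith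
    qed
    have "\<forall>\<^sub>F (z, s) in nhds z0 \<times>\<^sub>F nhds s0. (dist z z0 < r \<and> dist (deriv (\<phi> s0) z) (deriv (\<phi> s0) z0) < e / 2)
        \<and> (s \<in> {0..} \<longrightarrow> (\<forall>w\<in>cball z0 (2 * r). dist (\<phi> s w) (\<phi> s0 w) < e / 2 * r))"
      using eventually_prodI[OF ev2 ev1] by (simp add: case_prod_unfold)
    then have "\<forall>\<^sub>F x in nhds z0 \<times>\<^sub>F nhds s0. x \<in> \<bbbD> \<times> {0..} \<longrightarrow>
        dist (case x of (z, s) \<Rightarrow> deriv (\<phi> s) z) (deriv (\<phi> s0) z0) < e"
      by (rule eventually_mono) (use key in \<open>auto simp del: mem_cball\<close>)
    then show "\<forall>\<^sub>F x in at (z0, s0) within \<bbbD> \<times> {0..}.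
        dist (case x of (z, s) \<Rightarrow> deriv (\<phi> s) z) (deriv (\<phi> s0) z0) < e"
      unfolding eventually_at_filter nhds_prod by (rule eventually_mono) auto
  qed
  then show ?thesis unfolding continuous_on_def by force
qed

text \<open>Averaging the semigroup over \<open>[0, a]\<close> linearises the differentiability question:
  \<open>t \<mapsto> orbit_avg \<phi> a (\<phi> t z)\<close> is an integral over a moving window, hence differentiable,
  and \<open>orbit_avg \<phi> a\<close> is locally biholomorphic for small \<open>a\<close>.\<close>

definition orbit_avg :: "(real \<Rightarrow> complex \<Rightarrow> complex) \<Rightarrow> real \<Rightarrow> complex \<Rightarrow> complex" where
  "orbit_avg \<phi> a z = integral {0..a} (\<lambda>s. \<phi> s z)"

lemma orbit_avg_has_field_derivative:
  assumes \<phi>: "holomorphic_semigroup \<phi>" and z: "z \<in> \<bbbD>"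
  shows "(orbit_avg \<phi> a has_field_derivative integral {0..a} (\<lambda>s. deriv (\<phi> s) z)) (at z)"
proof -
  have "((\<lambda>z. integral (cbox 0 a) (\<lambda>s. \<phi> s z)) has_field_derivative integral (cbox 0 a) (\<lambda>s. deriv (\<phi> s) z)) (at z within \<bbbD>)"
  proof (rule leibniz_rule_field_derivative)
    fix x t assume x: "x \<in> \<bbbD>" and t: "t \<in> cbox 0 a"
    then have "\<phi> t field_differentiable at x"
      using semigroupD(1)[OF \<phi>, of t] by (auto intro: holomorphic_on_imp_differentiable_at)
    then show "(\<phi> t has_field_derivative deriv (\<phi> t) x) (at x within \<bbbD>)"
      by (simp add: field_differentiable_derivI has_field_derivative_at_within)
  next
    fix x assume "x \<in> \<bbbD>"
    then show "(\<lambda>s. \<phi> s x) integrable_on cbox 0 a"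
      by (intro integrable_continuous continuous_on_subset[OF semigroup_continuous_on[OF \<phi>]]) auto
  next
    show "continuous_on (\<bbbD> \<times> cbox 0 a) (\<lambda>(x, t). deriv (\<phi> t) x)"
      by (rule continuous_on_subset[OF semigroup_deriv_continuous[OF \<phi>]]) auto
  qed (use z in auto)
  then show ?thesis
    using z at_within_open[of z \<bbbD>] by (simp add: orbit_avg_def[abs_def])
qed

lemma orbit_avg_holomorphic: "holomorphic_semigroup \<phi> \<Longrightarrow> orbit_avg \<phi> a holomorphic_on \<bbbD>"
  by (rule holomorphic_onI) (meson field_differentiable_at_within field_differentiable_def orbit_avg_has_field_derivative)

text \<open>As \<open>\<phi> 0\<close> is the identity, \<open>deriv (\<phi> s) z\<close> is within
  1/2 of 1 for small \<open>s\<close>, so its integral over \<open>{0..a}\<close> is within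
  \<open>a / 2\<close> of \<open>a\<close>.\<close>

lemma orbit_avg_deriv_nonzero:
  assumes \<phi>: "holomorphic_semigroup \<phi>" and z: "z \<in> \<bbbD>"
  obtains a where "a > 0" "deriv (orbit_avg \<phi> a) z \<noteq> 0"
proof -
  have "continuous_on {0::real..} (\<lambda>s. (z, s))" by (intro continuous_intros)
  then have cont: "continuous_on {0..} (\<lambda>s. deriv (\<phi> s) z)"
    using continuous_on_compose2[OF semigroup_deriv_continuous[OF \<phi>], of "{0..}" "\<lambda>s. (z, s)"] z
    by (auto simp: image_subset_iff)
  have "deriv (\<phi> 0) z = deriv (\<lambda>w. w) z"
    by (rule deriv_cong_ev) (use z semigroupD(3)[OF \<phi>] in \<open>auto intro!: eventually_nhds_in_open[THEN eventually_mono, of \<bbbD>]\<close>)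
  then have d0: "deriv (\<phi> 0) z = 1" by simp
  obtain d where d: "d > 0" "\<And>s. s \<in> {0..} \<Longrightarrow> dist s 0 < d \<Longrightarrow> dist (deriv (\<phi> s) z) 1 < 1 / 2"
    using cont[unfolded continuous_on_iff, rule_format, of 0 "1/2"] d0 by auto
  define a where "a = d / 2"
  have a: "a > 0" using d by (simp add: a_def)
  have int: "(\<lambda>s. deriv (\<phi> s) z) integrable_on {0..a}"
    by (intro integrable_continuous_interval continuous_on_subset[OF cont]) auto
  have "norm (integral {0..a} (\<lambda>s. deriv (\<phi> s) z - 1)) \<le> 1 / 2 * (a - 0)"
  proof (rule integral_bound)
    show "continuous_on {0..a} (\<lambda>s. deriv (\<phi> s) z - 1)"
      by (intro continuous_intros continuous_on_subset[OF cont]) auto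
    fix s assume "s \<in> {0..a}"
    then show "norm (deriv (\<phi> s) z - 1) \<le> 1 / 2" using d(2)[of s] d(1) by (auto simp: a_def dist_norm)
  qed (use a in auto)
  moreover have "integral {0..a} (\<lambda>s. deriv (\<phi> s) z - 1) = integral {0..a} (\<lambda>s. deriv (\<phi> s) z) - of_real a"
    using int a by (subst integral_diff) (auto simp: scaleR_conv_of_real)
  ultimately have "integral {0..a} (\<lambda>s. deriv (\<phi> s) z) \<noteq> 0" using a by auto
  then have "deriv (orbit_avg \<phi> a) z \<noteq> 0"
    using DERIV_imp_deriv[OF orbit_avg_has_field_derivative[OF \<phi> z]] by simp
  with a show ?thesis using that by blast
qed

lemma orbit_avg_along_orbit:
  assumes \<phi>: "holomorphic_semigroup \<phi>" and z: "z \<in> \<bbbD>" and at: "a \<ge> 0" "t \<ge> 0"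
  shows "orbit_avg \<phi> a (\<phi> t z) = integral {0..a + t} (\<lambda>s. \<phi> s z) - integral {0..t} (\<lambda>s. \<phi> s z)"
proof -
  have cont: "continuous_on S (\<lambda>s. \<phi> s z)" if "S \<subseteq> {0..}" for S
    using semigroup_continuous_on[OF \<phi> z] that continuous_on_subset by blast
  have "orbit_avg \<phi> a (\<phi> t z) = integral {0..a} ((\<lambda>s. \<phi> s z) \<circ> (\<lambda>s. s + t))"
    unfolding orbit_avg_def using semigroupD(4)[OF \<phi>] z at by (intro integral_cong) auto
  also have "\<dots> = integral {0 + t..a + t} (\<lambda>s. \<phi> s z)"
    by (rule integral_shift, rule cont) (use at in auto)
  also have "\<dots> = integral {0..a + t} (\<lambda>s. \<phi> s z) - integral {0..t} (\<lambda>s. \<phi> s z)"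
  proof -
    have "(\<lambda>s. \<phi> s z) integrable_on {0..a + t}"
      by (intro integrable_continuous_interval cont) auto
    from Henstock_Kurzweil_Integration.integral_combine[OF at(2) _ this] show ?thesis using at by (simp add: algebra_simps)
  qed
  finally show ?thesis .
qed

lemma orbit_integral_has_vector_derivative:
  assumes \<phi>: "holomorphic_semigroup \<phi>" and z: "z \<in> \<bbbD>" and t: "t \<ge> 0"
  shows "((\<lambda>t. integral {0..t} (\<lambda>s. \<phi> s z)) has_vector_derivative \<phi> t z) (at t within {0..})"
proof -
  have "((\<lambda>t. integral {0..t} (\<lambda>s. \<phi> s z)) has_vector_derivative \<phi> t z) (at t within {0..t + 1})"
    by (intro integral_has_vector_derivative continuous_on_subset[OF semigroup_continuous_on[OF \<phi> z]]) (use t in auto)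
  moreover have "at t within {0..t + 1} = at t within {0..}"
    by (rule at_within_nhd[of t "{..<t+1}"]) auto
  ultimately show ?thesis by simp
qed

text \<open>The averaged orbit is \<open>I (a + u) - I u\<close>, differentiable by the fundamental
  theorem of calculus; a local holomorphic inverse of the average carries this back to the orbit
  itself.\<close>

lemma orbit_has_vector_derivative:
  assumes \<phi>: "holomorphic_semigroup \<phi>" and z: "z \<in> \<bbbD>" and t: "t \<ge> 0" and a: "a \<ge> 0"
    and nz: "deriv (orbit_avg \<phi> a) (\<phi> t z) \<noteq> 0"
  shows "((\<lambda>t. \<phi> t z) has_vector_derivative (\<phi> a (\<phi> t z) - \<phi> t z) / deriv (orbit_avg \<phi> a) (\<phi> t z)) (at t within {0..})"
proof -
  define F where "F = orbit_avg \<phi> a"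
  define w where "w = \<phi> t z"
  define I where "I u = integral {0..u} (\<lambda>s. \<phi> s z)" for u
  have w: "w \<in> \<bbbD>" using semigroupD(2)[OF \<phi> t z] by (simp add: w_def)
  have F: "F holomorphic_on \<bbbD>" using orbit_avg_holomorphic[OF \<phi>] by (simp add: F_def)
  obtain r where r: "r > 0" "ball w r \<subseteq> \<bbbD>" "inj_on F (ball w r)"
    using has_complex_derivative_locally_injective[OF F w] nz by (auto simp: F_def w_def)
  have Fr: "F holomorphic_on ball w r" using F r(2) by (rule holomorphic_on_subset)
  obtain g where g: "g holomorphic_on F ` ball w r" "\<And>x. x \<in> ball w r \<Longrightarrow> deriv F x * deriv g (F x) = 1"
    "\<And>x. x \<in> ball w r \<Longrightarrow> g (F x) = x"
    using holomorphic_has_inverse[OF Fr _ r(3)] by auto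
  have "open (F ` ball w r)" by (rule open_mapping_thm3[OF Fr _ r(3)]) auto
  then have "(g has_field_derivative deriv g (F w)) (at (F w))"
    using g(1) r(1) by (intro holomorphic_derivI) auto
  then have dg: "(g has_field_derivative 1 / deriv F w) (at (F w))"
    using g(2)[of w] r(1) by (simp add: field_simps nonzero_eq_divide_eq) (metis mult_eq_0_iff nonzero_mult_div_cancel_left zero_neq_one)
  have dI: "(I has_vector_derivative \<phi> u z) (at u within {0..})" if "u \<ge> 0" for u
    unfolding I_def by (rule orbit_integral_has_vector_derivative[OF \<phi> z that])
  have "((I \<circ> (\<lambda>u. a + u)) has_vector_derivative 1 *\<^sub>R \<phi> (a + t) z) (at t within {0..})"
  proof (rule vector_diff_chain_within)
    show "((\<lambda>u. a + u) has_vector_derivative 1) (at t within {0..})"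
      by (auto intro!: derivative_eq_intros)
    show "(I has_vector_derivative \<phi> (a + t) z) (at (a + t) within (+) a ` {0..})"
      by (rule has_vector_derivative_within_subset[OF dI]) (use a t in auto)
  qed
  then have "((\<lambda>u. I (a + u) - I u) has_vector_derivative \<phi> (a + t) z - \<phi> t z) (at t within {0..})"
    using dI[OF t] by (intro has_vector_derivative_diff) (auto simp: o_def)
  moreover have FI: "F (\<phi> u z) = I (a + u) - I u" if "u \<ge> 0" for u
    unfolding F_def I_def by (rule orbit_avg_along_orbit[OF \<phi> z a that])
  ultimately have "((g \<circ> (\<lambda>u. I (a + u) - I u)) has_vector_derivative (\<phi> (a + t) z - \<phi> t z) * (1 / deriv F w)) (at t within {0..})"
    using dg FI[OF t] by (intro field_vector_diff_chain_within) (auto simp: w_def has_field_derivative_at_within)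
  moreover
  obtain d where d: "d > 0" "\<And>u. u \<in> {0..} \<Longrightarrow> dist u t < d \<Longrightarrow> dist (\<phi> u z) w < r"
    using semigroup_continuous_on[OF \<phi> z, unfolded continuous_on_iff, rule_format, of t r] t r(1)
    by (auto simp: w_def)
  ultimately have "((\<lambda>u. \<phi> u z) has_vector_derivative (\<phi> (a + t) z - \<phi> t z) * (1 / deriv F w)) (at t within {0..})"
    using g(3) FI t by (elim has_vector_derivative_transform_within[of _ _ _ _ d]) (auto simp: dist_commute simp flip: FI)
  then show ?thesis
    using semigroupD(4)[OF \<phi> a t z] by (simp add: F_def w_def)
qed

theorem semigroup_generator:
  assumes \<phi>: "holomorphic_semigroup \<phi>"
  obtains G where "G holomorphic_on \<bbbD>"
    "\<And>t z. t \<ge> 0 \<Longrightarrow> z \<in> \<bbbD> \<Longrightarrow> ((\<lambda>t. \<phi> t z) has_vector_derivative G (\<phi> t z)) (at t within {0..})"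
proof -
  \<comment> \<open>Defined as a derivative at time 0, \<open>G\<close> does not depend on
    \<open>a\<close>. The quotients obtained from different \<open>a\<close> therefore agree, and
    holomorphy can be checked on each open set \<open>N a\<close>.\<close>
  define G where "G w = vector_derivative (\<lambda>t. \<phi> t w) (at 0 within {0..})" for w
  have nb: "at (0::real) within {0..} \<noteq> bot" by (simp add: at_within_Ici_at_right)
  have G: "G w = (\<phi> a w - w) / deriv (orbit_avg \<phi> a) w"
    if "w \<in> \<bbbD>" "a \<ge> 0" "deriv (orbit_avg \<phi> a) w \<noteq> 0" for a w
    unfolding G_def
    using orbit_has_vector_derivative[OF \<phi> that(1) order_refl that(2)] that semigroupD(3)[OF \<phi>]
    by (intro vector_derivative_within nb) auto
  define N where "N a = {w \<in> \<bbbD>. deriv (orbit_avg \<phi> a) w \<noteq> 0}" for a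
  have dhol: "deriv (orbit_avg \<phi> a) holomorphic_on \<bbbD>" for a
    by (intro holomorphic_deriv orbit_avg_holomorphic[OF \<phi>]) auto
  have "G holomorphic_on (\<Union>a\<in>{0<..}. N a)"
  proof (rule holomorphic_on_UN_open)
    fix a :: real assume a: "a \<in> {0<..}"
    have "(\<lambda>w. (\<phi> a w - w) / deriv (orbit_avg \<phi> a) w) holomorphic_on N a"
      using a by (intro holomorphic_intros holomorphic_on_subset[OF semigroupD(1)[OF \<phi>]] holomorphic_on_subset[OF dhol])
        (auto simp: N_def)
    then show "G holomorphic_on N a"
      by (rule holomorphic_transform) (use a in \<open>auto simp: N_def G[of _ a]\<close>)
    have "open (deriv (orbit_avg \<phi> a) -` (- {0}) \<inter> \<bbbD>)"
      using holomorphic_on_imp_continuous_on[OF dhol] continuous_on_open_vimage[of \<bbbD>] by blast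
    then show "open (N a)" by (simp add: N_def vimage_def Int_def conj_commute)
  qed
  moreover have "(\<Union>a\<in>{0<..}. N a) = \<bbbD>"
    using orbit_avg_deriv_nonzero[OF \<phi>] by (fastforce simp: N_def)
  ultimately have "G holomorphic_on \<bbbD>" by simp
  moreover have "((\<lambda>t. \<phi> t z) has_vector_derivative G (\<phi> t z)) (at t within {0..})" if t: "t \<ge> 0" and z: "z \<in> \<bbbD>" for t z
  proof -
    have w: "\<phi> t z \<in> \<bbbD>" using semigroupD(2)[OF \<phi> t z] .
    obtain a where a: "a > 0" "deriv (orbit_avg \<phi> a) (\<phi> t z) \<noteq> 0" using orbit_avg_deriv_nonzero[OF \<phi> w] .
    show ?thesis using orbit_has_vector_derivative[OF \<phi> z t _ a(2)] G[OF w _ a(2)] a(1) by simp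
  qed
  ultimately show ?thesis using that by blast
qed

subsection \<open>The Koenigs function\<close>

text \<open>Along the segment from \<open>v\<close> to \<open>w\<close> the function
  \<open>Re (c / (w - v) * K)\<close> has derivative \<open>Re (c * K')\<close>, which is positive,
  so it cannot take equal values at the ends.\<close>

lemma Noshiro_Warschawski:
  assumes S: "convex S" and K: "\<And>w. w \<in> S \<Longrightarrow> (K has_field_derivative K' w) (at w within S)"
    and pos: "\<And>w. w \<in> S \<Longrightarrow> Re (c * K' w) > 0"
  shows "inj_on K S"
proof (rule inj_onI, rule ccontr)
  fix v w assume vw: "v \<in> S" "w \<in> S" "K v = K w" "v \<noteq> w"
  define \<gamma> where "\<gamma> u = v + u *\<^sub>R (w - v)" for u :: real
  have \<gamma>S: "\<gamma> ` {0..1} \<subseteq> S"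
  proof clarify
    fix u :: real assume "u \<in> {0..1}"
    then have "(1 - u) *\<^sub>R v + u *\<^sub>R w \<in> S" using S vw by (auto simp: convex_alt)
    moreover have "(1 - u) *\<^sub>R v + u *\<^sub>R w = \<gamma> u" by (simp add: \<gamma>_def algebra_simps)
    ultimately show "\<gamma> u \<in> S" by simp
  qed
  have dK: "((K \<circ> \<gamma>) has_vector_derivative (w - v) * K' (\<gamma> u)) (at u within {0..1})" if u: "u \<in> {0..1}" for u
  proof (rule field_vector_diff_chain_within)
    show "(\<gamma> has_vector_derivative (w - v)) (at u within {0..1})"
      unfolding \<gamma>_def by (auto intro!: derivative_eq_intros)
    show "(K has_field_derivative K' (\<gamma> u)) (at (\<gamma> u) within \<gamma> ` {0..1})"
      using \<gamma>S u by (intro DERIV_subset[OF K \<gamma>S]) auto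
  qed
  have d: "((\<lambda>u. Re (c / (w - v) * K (\<gamma> u))) has_vector_derivative Re (c * K' (\<gamma> u))) (at u within {0..1})"
    if u: "u \<in> {0..1}" for u
  proof -
    have "((\<lambda>u. c / (w - v) * (K \<circ> \<gamma>) u) has_vector_derivative (c / (w - v) * ((w - v) * K' (\<gamma> u)))) (at u within {0..1})"
      by (intro has_vector_derivative_mult_right dK u)
    moreover have "c / (w - v) * ((w - v) * K' (\<gamma> u)) = c * K' (\<gamma> u)" using vw(4) by simp
    ultimately have "((\<lambda>u. c / (w - v) * K (\<gamma> u)) has_vector_derivative c * K' (\<gamma> u)) (at u within {0..1})"
      by (simp only: o_def)
    then show ?thesis by (rule bounded_linear.has_vector_derivative[OF bounded_linear_Re])
  qed
  have "\<exists>u\<in>{0..1}. Re (c / (w - v) * K (\<gamma> 1)) - Re (c / (w - v) * K (\<gamma> 0)) = (1 - 0) *\<^sub>R Re (c * K' (\<gamma> u))"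
    by (rule mvt_very_simple) (use d in \<open>simp_all add: has_vector_derivative_def\<close>)
  moreover have "\<gamma> 0 = v" "\<gamma> 1 = w" by (auto simp: \<gamma>_def)
  ultimately obtain u where u: "u \<in> {0..1}" "Re (c * K' (\<gamma> u)) = 0" using vw(3) by auto
  have "\<gamma> u \<in> S" using \<gamma>S u(1) by blast
  from pos[OF this] u(2) show False by linarith
qed

text \<open>By the open mapping theorem a nonconstant \<open>P\<close> avoids the imaginary axis,
  and \<open>c = 1\<close> works. The factor exists for imaginary constants, which arise from
  parabolic automorphisms; there \<open>c = p\<close> makes the product 1.\<close>

lemma nonneg_Re_imp_pos_Re_multiple:
  assumes P: "P holomorphic_on S" "open S" "connected S" and nn: "\<And>z. z \<in> S \<Longrightarrow> Re (P z) \<ge> 0"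
    and nz: "\<exists>z\<in>S. P z \<noteq> 0"
  obtains c where "\<And>z. z \<in> S \<Longrightarrow> P z \<noteq> 0 \<and> Re (c * (1 / P z)) > 0"
proof (cases "P constant_on S")
  case True
  then obtain p where p: "\<And>z. z \<in> S \<Longrightarrow> P z = p" unfolding constant_on_def by blast
  then have "p \<noteq> 0" using nz by blast
  show ?thesis by (rule that[of p]) (simp add: p \<open>p \<noteq> 0\<close>)
next
  case False
  have op: "open (P ` S)" by (rule open_mapping_thm[OF P P(2) order_refl False])
  have pos: "Re (P z) > 0" if z: "z \<in> S" for z
  proof (rule ccontr)
    assume "\<not> Re (P z) > 0"
    then have 0: "Re (P z) = 0" using nn[OF z] by simp
    obtain e where e: "e > 0" "ball (P z) e \<subseteq> P ` S" using op imageI[OF z, of P] unfolding open_contains_ball by metis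
    have "P z - of_real (e / 2) \<in> ball (P z) e" using e(1) by (simp add: dist_norm)
    then obtain y where "y \<in> S" "P y = P z - of_real (e / 2)" using e(2) by (metis imageE subsetD)
    then show False using nn[of y] 0 e(1) by simp
  qed
  have "P z \<noteq> 0 \<and> Re (1 * (1 / P z)) > 0" if "z \<in> S" for z
  proof -
    have "P z \<noteq> 0" using pos[OF that] by auto
    moreover have "Re (1 / P z) = Re (P z) / (norm (P z))\<^sup>2" by (simp add: Re_divide cmod_power2)
    ultimately show ?thesis using pos[OF that] by simp
  qed
  then show ?thesis using that[of 1] by blast
qed

lemma nonneg_right_derivative:
  fixes f :: "real \<Rightarrow> real"
  assumes f: "(f has_vector_derivative D) (at 0 within {0..})" and mono: "\<And>t. t \<ge> 0 \<Longrightarrow> f t \<ge> f 0"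
  shows "D \<ge> 0"
proof -
  have "((\<lambda>y. (f y - f 0) / (y - 0)) \<longlongrightarrow> D) (at 0 within {0..})"
    using f unfolding has_real_derivative_iff_has_vector_derivative[symmetric] has_field_derivative_iff .
  moreover have "\<forall>\<^sub>F y in at 0 within {0..}. (f y - f 0) / (y - 0) \<ge> 0"
    unfolding eventually_at_filter by (rule always_eventually) (use mono in auto)
  moreover have "at (0::real) within {0..} \<noteq> bot" by (simp add: at_within_Ici_at_right)
  ultimately show ?thesis by (rule tendsto_lowerbound)
qed

lemma elliptic_if_generator_zero:
  assumes G: "\<And>t z. t \<ge> 0 \<Longrightarrow> z \<in> \<bbbD> \<Longrightarrow> ((\<lambda>t. \<phi> t z) has_vector_derivative G (\<phi> t z)) (at t within {0..})"
    and 0: "\<And>z. z \<in> \<bbbD> \<Longrightarrow> G z = 0" and \<phi>: "holomorphic_semigroup \<phi>"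
  shows "elliptic \<phi>"
proof -
  have "((\<lambda>t. \<phi> t 0) has_vector_derivative 0) (at t within {0..})" if "t \<in> {0..}" for t
    using G[of t 0] 0[OF semigroupD(2)[OF \<phi>], of t 0] that by auto
  then obtain c where "\<And>t. t \<in> {0..} \<Longrightarrow> \<phi> t 0 = c"
    using has_vector_derivative_zero_constant[of "{0..}" "\<lambda>t. \<phi> t 0"] by auto
  then have "\<phi> t 0 = 0" if "t \<ge> 0" for t using semigroupD(3)[OF \<phi>, of 0] that by (metis atLeast_iff centre_in_ball order_refl zero_less_one)
  then show ?thesis unfolding elliptic_def by (intro bexI[of _ 0]) auto
qed


text \<open>\<open>P\<close> below is the generator transported to the right half-plane by the Cayley transform
  \<open>C\<close> taking the Wolff point to infinity; horodisc invariance says \<open>Re P \<ge> 0\<close> (the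
  Berkson--Porta formula), which makes the primitive of \<open>1 / P\<close> univalent.\<close>

theorem Koenigs_function:
  assumes \<phi>: "holomorphic_semigroup \<phi>" and ne: "\<not> elliptic \<phi>"
  obtains h where "h holomorphic_on \<bbbD>" "inj_on h \<bbbD>"
    "\<And>t z. t \<ge> 0 \<Longrightarrow> z \<in> \<bbbD> \<Longrightarrow> h (\<phi> t z) = h z + of_real t"
proof -
  obtain \<tau> where \<tau>: "norm \<tau> = 1" "\<And>t z. t \<ge> 0 \<Longrightarrow> z \<in> \<bbbD> \<Longrightarrow> horo \<tau> (\<phi> t z) \<le> horo \<tau> z"
    using semigroup_Wolff[OF \<phi> ne] by blast
  obtain G where G: "G holomorphic_on \<bbbD>"
    "\<And>t z. t \<ge> 0 \<Longrightarrow> z \<in> \<bbbD> \<Longrightarrow> ((\<lambda>t. \<phi> t z) has_vector_derivative G (\<phi> t z)) (at t within {0..})"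
    using semigroup_generator[OF \<phi>] by blast
  have \<tau>0: "\<tau> \<noteq> 0" using \<tau>(1) by auto
  have nz: "\<tau> - z \<noteq> 0" if "z \<in> \<bbbD>" for z using that \<tau>(1) by auto
  define C where "C z = (\<tau> + z) / (\<tau> - z)" for z
  define B where "B w = \<tau> * ((w - 1) / (w + 1))" for w :: complex
  define C' where "C' z = 2 * \<tau> / (\<tau> - z)\<^sup>2" for z
  have dC: "(C has_field_derivative C' z) (at z)" if "z \<in> \<bbbD>" for z
    unfolding C_def[abs_def] C'_def using nz[OF that]
    by (auto intro!: derivative_eq_intros simp: divide_simps power2_eq_square)
  have ReC: "Re (C z) = 1 / horo \<tau> z" if "z \<in> \<bbbD>" for z
  proof -
    have "Re (C z) = ((norm \<tau>)\<^sup>2 - (norm z)\<^sup>2) / (norm (\<tau> - z))\<^sup>2"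
      unfolding C_def by (simp add: Re_divide cmod_power2) (simp add: power2_eq_square algebra_simps)
    then show ?thesis by (simp add: \<tau>(1) horo_def)
  qed
  have CH: "Re (C z) > 0" if "z \<in> \<bbbD>" for z using ReC[OF that] horo_pos[OF \<tau>(1) that] by simp
  have BD: "B w \<in> \<bbbD>" if "Re w > 0" for w
    using Cayley_in_disc[OF that] \<tau>(1) by (simp add: B_def norm_mult norm_divide)
  have BC: "B (C z) = z" if "z \<in> \<bbbD>" for z
  proof -
    have "C z - 1 = 2 * z / (\<tau> - z)" "C z + 1 = 2 * \<tau> / (\<tau> - z)"
      using nz[OF that] by (simp_all add: C_def divide_simps)
    then show ?thesis using nz[OF that] \<tau>0 by (simp add: B_def)
  qed
  define P where "P z = C' z * G z" for z
  have P: "P holomorphic_on \<bbbD>"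
    unfolding P_def C'_def using nz by (intro holomorphic_intros G(1)) auto
  have dCorb: "((\<lambda>t. C (\<phi> t z)) has_vector_derivative P z) (at 0 within {0..})" if z: "z \<in> \<bbbD>" for z
  proof -
    have "((C \<circ> (\<lambda>t. \<phi> t z)) has_vector_derivative (G (\<phi> 0 z) * C' (\<phi> 0 z))) (at 0 within {0..})"
      using G(2)[of 0 z] z dC[OF semigroupD(2)[OF \<phi>, of 0 z]]
      by (intro field_vector_diff_chain_within) (auto simp: has_field_derivative_at_within)
    then show ?thesis using semigroupD(3)[OF \<phi> z] by (simp add: P_def o_def mult.commute)
  qed
  have "Re (P z) \<ge> 0" if z: "z \<in> \<bbbD>" for z
  proof (rule nonneg_right_derivative)
    show "((\<lambda>t. Re (C (\<phi> t z))) has_vector_derivative Re (P z)) (at 0 within {0..})"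
      using bounded_linear.has_vector_derivative[OF bounded_linear_Re dCorb[OF z]] .
    fix t :: real assume t: "t \<ge> 0"
    show "Re (C (\<phi> 0 z)) \<le> Re (C (\<phi> t z))"
      using \<tau>(2)[OF t z] horo_pos[OF \<tau>(1)] semigroupD(2)[OF \<phi> t z] z
      by (simp add: semigroupD(3)[OF \<phi> z] ReC divide_simps)
  qed
  moreover have "\<exists>z\<in>\<bbbD>. P z \<noteq> 0"
  proof (rule ccontr)
    assume *: "\<not> (\<exists>z\<in>\<bbbD>. P z \<noteq> 0)"
    have "G z = 0" if z: "z \<in> \<bbbD>" for z
    proof -
      have "C' z \<noteq> 0" using nz[OF z] \<tau>0 by (simp add: C'_def)
      then show ?thesis using * z by (auto simp: P_def)
    qed
    then show False using elliptic_if_generator_zero[OF G(2) _ \<phi>] ne by blast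
  qed
  ultimately obtain c where c: "\<And>z. z \<in> \<bbbD> \<Longrightarrow> P z \<noteq> 0 \<and> Re (c * (1 / P z)) > 0"
    using nonneg_Re_imp_pos_Re_multiple[OF P open_ball connected_ball] by metis
  let ?H = "{w. Re w > 0}"
  have H: "open ?H" "convex ?H" by (auto simp: open_halfspace_Re_gt convex_halfspace_Re_gt)
  have Bhol: "B holomorphic_on ?H" unfolding B_def by (intro holomorphic_intros) (auto simp: complex_eq_iff)
  have "(P \<circ> B) holomorphic_on ?H"
    using BD by (intro holomorphic_on_compose_gen[OF Bhol P]) auto
  then have "(\<lambda>w. 1 / P (B w)) holomorphic_on ?H"
    using c BD by (intro holomorphic_intros) (auto simp: o_def)
  \<comment> \<open>The primitive is taken in the half-plane because there the derivative is
    \<open>1 / P\<close>, with controlled argument. In the disc it becomes \<open>1 / G\<close>, for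
    which no such control is available.\<close>
  then obtain K where K: "\<And>w. w \<in> ?H \<Longrightarrow> (K has_field_derivative 1 / P (B w)) (at w within ?H)"
    using holomorphic_convex_primitive'[of ?H "\<lambda>w. 1 / P (B w)"] H by metis
  have injK: "inj_on K ?H"
    by (rule Noshiro_Warschawski[OF H(2) K]) (use c BD in auto)
  define h where "h = K \<circ> C"
  have dh: "(h has_field_derivative 1 / G z) (at z)" if z: "z \<in> \<bbbD>" for z
  proof -
    have "(K has_field_derivative 1 / P (B (C z))) (at (C z))"
      using K[of "C z"] CH[OF z] at_within_open[of "C z" ?H] H by auto
    then have "((K \<circ> C) has_field_derivative (1 / P (B (C z))) * C' z) (at z)"
      by (intro DERIV_chain dC z)
    moreover have "(1 / P (B (C z))) * C' z = 1 / G z"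
      using c[OF z] BC[OF z] by (auto simp: P_def)
    ultimately show ?thesis by (simp add: h_def)
  qed
  have "h holomorphic_on \<bbbD>"
    by (rule holomorphic_onI) (meson dh field_differentiable_at_within field_differentiable_def)
  moreover have "inj_on h \<bbbD>"
  proof (rule inj_onI)
    fix x y assume xy: "x \<in> \<bbbD>" "y \<in> \<bbbD>" "h x = h y"
    then have "C x = C y" using inj_onD[OF injK, of "C x" "C y"] CH by (auto simp: h_def)
    then show "x = y" using BC xy by metis
  qed
  moreover have "h (\<phi> t z) = h z + of_real t" if t: "t \<ge> 0" and z: "z \<in> \<bbbD>" for t z
  proof -
    \<comment> \<open>Since \<open>h\<close> has derivative \<open>1 / G\<close>, it straightens the
      flow: orbits move with velocity 1 in its image.\<close>
    have "((\<lambda>t. h (\<phi> t z) - of_real t) has_vector_derivative 0) (at t within {0..})" if t: "t \<in> {0..}" for t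
    proof -
      have w: "\<phi> t z \<in> \<bbbD>" using semigroupD(2)[OF \<phi> _ z] t by auto
      have "((h \<circ> (\<lambda>t. \<phi> t z)) has_vector_derivative (G (\<phi> t z) * (1 / G (\<phi> t z)))) (at t within {0..})"
        using G(2)[of t z] z t dh[OF w]
        by (intro field_vector_diff_chain_within) (auto simp: has_field_derivative_at_within)
      moreover have "G (\<phi> t z) \<noteq> 0" using c[OF w] by (auto simp: P_def)
      ultimately have "((\<lambda>t. h (\<phi> t z)) has_vector_derivative 1) (at t within {0..})" by (simp add: o_def)
      then have "((\<lambda>t. h (\<phi> t z) - of_real t) has_vector_derivative 1 - 1) (at t within {0..})"
        by (intro has_vector_derivative_diff) (auto intro!: derivative_eq_intros simp: has_vector_derivative_def scaleR_conv_of_real)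
      then show ?thesis by simp
    qed
    then obtain k where k: "\<And>t. t \<in> {0..} \<Longrightarrow> h (\<phi> t z) - of_real t = k"
      using has_vector_derivative_zero_constant[of "{0..}" "\<lambda>t. h (\<phi> t z) - of_real t"] by auto
    show ?thesis using k[of t] k[of 0] t semigroupD(3)[OF \<phi> z] by (simp add: algebra_simps)
  qed
  ultimately show ?thesis by (rule that)
qed

subsection \<open>Translations of a domain in a strip\<close>

text \<open>This follows from \<open>|\<tau> - z| \<ge> 1 - |z| \<ge> (1 - |z|^2) / 2\<close>. It
  converts a slow approach to the circle into a lower bound for \<open>horo\<close>.\<close>

lemma horo_lower_bound:
  assumes "norm \<tau> = 1" "z \<in> \<bbbD>"
  shows "(1 - (norm z)\<^sup>2) / 4 \<le> horo \<tau> z"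
proof -
  have z: "norm z < 1" using assms by simp
  have p: "1 - (norm z)\<^sup>2 > 0" using one_minus_norm_sq_pos[OF assms(2)] .
  have "(1 - (norm z)\<^sup>2) / 2 = (1 - norm z) * ((1 + norm z) / 2)" by (simp add: power2_eq_square algebra_simps)
  also have "\<dots> \<le> (1 - norm z) * 1" using z by (intro mult_left_mono) auto
  also have "\<dots> \<le> norm (\<tau> - z)" using norm_triangle_ineq2[of \<tau> z] assms(1) by simp
  finally have "((1 - (norm z)\<^sup>2) / 2)\<^sup>2 \<le> (norm (\<tau> - z))\<^sup>2" using p by (intro power_mono) auto
  then show ?thesis using p unfolding horo_def by (simp add: field_simps power2_eq_square)
qed

text \<open>The bound reads \<open>|\<tau> - u|^2 \<le> M * (1 - |u|^2)\<close>: a horodisc meets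
  the circle only at its centre \<open>\<tau>\<close>.\<close>

lemma tendsto_if_horo_bounded:
  fixes u :: "'a \<Rightarrow> complex"
  assumes u: "\<forall>\<^sub>F x in F. u x \<in> \<bbbD> \<and> horo \<tau> (u x) \<le> M"
    and lim: "((\<lambda>x. 1 - (norm (u x))\<^sup>2) \<longlongrightarrow> 0) F"
  shows "(u \<longlongrightarrow> \<tau>) F"
proof -
  have "\<forall>\<^sub>F x in F. norm ((norm (u x - \<tau>))\<^sup>2) \<le> M * (1 - (norm (u x))\<^sup>2)"
    using u
  proof eventually_elim
    case (elim x)
    then show ?case using one_minus_norm_sq_pos[of "u x"] by (simp add: horo_def norm_minus_commute divide_le_eq)
  qed
  moreover have "((\<lambda>x. M * (1 - (norm (u x))\<^sup>2)) \<longlongrightarrow> 0) F" by (rule tendsto_mult_right_zero[OF lim])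
  ultimately have "((\<lambda>x. (norm (u x - \<tau>))\<^sup>2) \<longlongrightarrow> 0) F"
    by (rule Lim_null_comparison)
  then have "((\<lambda>x. sqrt ((norm (u x - \<tau>))\<^sup>2)) \<longlongrightarrow> sqrt 0) F" by (intro tendsto_intros)
  then show ?thesis by (simp add: tendsto_norm_zero_iff LIM_zero_iff)
qed

lemma geometric_bound_ge_1:
  fixes c r :: real
  assumes "c > 0" "r \<ge> 0" and bd: "\<And>n. c \<le> M * r ^ n"
  shows "r \<ge> 1"
proof (rule ccontr)
  assume "\<not> r \<ge> 1"
  then have "(\<lambda>n. M * r ^ n) \<longlonglongrightarrow> M * 0"
    using assms(2) by (intro tendsto_intros LIMSEQ_realpow_zero) auto
  then have "c \<le> M * 0" by (rule LIMSEQ_le_const) (use bd in auto)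
  then show False using assms(1) by simp
qed

text \<open>\<open>f\<close> and \<open>g\<close> stand for a Riemann map onto \<open>V\<close> and
  its inverse. \<open>fill\<close> makes the strip minimal: every horizontal line in it meets
  \<open>V\<close>. Without this the decay of orbits could be faster than
  \<open>exp (- t)\<close>.\<close>

locale strip_model =
  fixes V :: "complex set" and f g :: "complex \<Rightarrow> complex"
  assumes open_V: "open V"
    and f_hol: "f holomorphic_on \<bbbD>" and g_hol: "g holomorphic_on V"
    and f_in: "z \<in> \<bbbD> \<Longrightarrow> f z \<in> V" and gf: "z \<in> \<bbbD> \<Longrightarrow> g (f z) = z"
    and g_in: "w \<in> V \<Longrightarrow> g w \<in> \<bbbD>" and fg: "w \<in> V \<Longrightarrow> f (g w) = w"
    and shift: "w \<in> V \<Longrightarrow> t \<ge> 0 \<Longrightarrow> w + of_real t \<in> V"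
    and strip: "w \<in> V \<Longrightarrow> \<bar>Im w\<bar> < pi / 2"
    and fill: "\<bar>y\<bar> < pi / 2 \<Longrightarrow> \<exists>x. Complex x y \<in> V"
begin

definition \<psi> :: "real \<Rightarrow> complex \<Rightarrow> complex" where
  "\<psi> t z = g (f z + of_real t)"

lemma \<psi>_in: "t \<ge> 0 \<Longrightarrow> z \<in> \<bbbD> \<Longrightarrow> \<psi> t z \<in> \<bbbD>"
  unfolding \<psi>_def by (intro g_in shift f_in)

lemma f_\<psi>: "t \<ge> 0 \<Longrightarrow> z \<in> \<bbbD> \<Longrightarrow> f (\<psi> t z) = f z + of_real t"
  unfolding \<psi>_def by (intro fg shift f_in)

lemma \<psi>_add: "s \<ge> 0 \<Longrightarrow> t \<ge> 0 \<Longrightarrow> z \<in> \<bbbD> \<Longrightarrow> \<psi> (s + t) z = \<psi> s (\<psi> t z)"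
  unfolding \<psi>_def[of s "\<psi> t z"] f_\<psi> by (simp add: \<psi>_def algebra_simps)

lemma holomorphic_semigroup_\<psi>: "holomorphic_semigroup \<psi>"
  unfolding holomorphic_semigroup_def
proof (intro conjI allI ballI impI)
  fix t :: real assume t: "t \<ge> 0"
  have "(g \<circ> (\<lambda>z. f z + of_real t)) holomorphic_on \<bbbD>"
    by (intro holomorphic_on_compose_gen[OF _ g_hol] holomorphic_intros f_hol) (use t shift f_in in auto)
  then show "\<psi> t holomorphic_on \<bbbD>" by (simp add: \<psi>_def[abs_def] o_def)
  show "\<psi> t ` \<bbbD> \<subseteq> \<bbbD>" using \<psi>_in[OF t] by blast
next
  fix z assume "z \<in> \<bbbD>" then show "\<psi> 0 z = z" by (simp add: \<psi>_def gf)
next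
  fix s t z assume "s \<ge> (0::real)" "t \<ge> (0::real)" "z \<in> \<bbbD>"
  then show "\<psi> (s + t) z = \<psi> s (\<psi> t z)" by (rule \<psi>_add)
next
  fix t :: real and K assume t: "t \<ge> 0" and K: "compact K \<and> K \<subseteq> \<bbbD>"
  have cf: "continuous_on K f"
    using K holomorphic_on_imp_continuous_on[OF f_hol] continuous_on_subset by blast
  have "continuous_on ({0..} \<times> K) (\<lambda>x. f (snd x) + of_real (fst x))"
    by (intro continuous_intros continuous_on_compose2[OF cf]) auto
  then have "continuous_on ({0..} \<times> K) (\<lambda>x. g (f (snd x) + of_real (fst x)))"
    by (rule continuous_on_compose2[OF holomorphic_on_imp_continuous_on[OF g_hol]]) (use K shift f_in in auto)
  then have cont: "continuous_on ({0..} \<times> K) (\<lambda>(s, z). \<psi> s z)" by (simp add: \<psi>_def case_prod_unfold)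
  show "uniform_limit K \<psi> (\<psi> t) (at t within {0..})"
  proof (rule uniform_limitI)
    fix e :: real assume e: "e > 0"
    obtain X where X: "t \<in> X" "open X" "\<forall>s\<in>X \<inter> {0..}. \<forall>z\<in>K. dist (\<psi> s z) (\<psi> t z) \<le> e / 2"
      using continuous_on_prod_compactE[OF cont _ _ half_gt_zero[OF e], of t] K t by auto
    have "\<forall>\<^sub>F s in at t within {0..}. s \<in> X \<inter> {0..}"
      using X(1,2) unfolding eventually_at_topological by auto
    then show "\<forall>\<^sub>F s in at t within {0..}. \<forall>z\<in>K. dist (\<psi> s z) (\<psi> t z) < e"
    proof eventually_elim
      case (elim s)
      show ?case
      proof
        fix z assume "z \<in> K"
        then have "dist (\<psi> s z) (\<psi> t z) \<le> e / 2" using X(3) elim by blast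
        then show "dist (\<psi> s z) (\<psi> t z) < e" using e by linarith
      qed
    qed
  qed
qed

lemma not_elliptic_\<psi>: "\<not> elliptic \<psi>"
proof
  assume "elliptic \<psi>"
  then obtain z where "z \<in> \<bbbD>" "\<psi> 1 z = z" unfolding elliptic_def by force
  then show False using f_\<psi>[of 1 z] by simp
qed

text \<open>The exponential maps the strip onto the right half-plane, where \<open>\<psi> s\<close> becomes
  multiplication by \<open>exp s\<close>.\<close>

lemma orbit_upper_bound:
  assumes z: "z \<in> \<bbbD>" and s: "s \<ge> 0"
  shows "1 - (norm (\<psi> s z))\<^sup>2 \<le> 16 / (1 - (norm z)\<^sup>2) * exp (- s)"
proof -
  define F where "F z = exp (f z)" for z
  define b where "b = \<psi> s z"
  have b: "b \<in> \<bbbD>" using \<psi>_in[OF s z] by (simp add: b_def)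
  have Fpos: "Re (F z) > 0" if "z \<in> \<bbbD>" for z
  proof -
    have "\<bar>Im (f z)\<bar> < pi / 2" using strip f_in that by blast
    then have "cos (Im (f z)) > 0" by (intro cos_gt_zero_pi) auto
    then show ?thesis by (simp add: F_def Re_exp)
  qed
  have Fb: "F b = of_real (exp s) * F z" unfolding F_def b_def f_\<psi>[OF s z] by (simp add: exp_add exp_of_real mult.commute)
  define R where "R = Re (F z)"
  have R: "R > 0" using Fpos z by (simp add: R_def)
  have pz: "1 - (norm z)\<^sup>2 > 0" "1 - (norm b)\<^sup>2 > 0" using one_minus_norm_sq_pos z b by auto
  \<comment> \<open>As \<open>F b\<close> is \<open>exp s * F z\<close>, the left side is quadratic
    in \<open>exp s\<close> and the right side linear, which leaves the decay
    \<open>exp (- s)\<close>. The 16 combines the 4 of the half-plane inequality with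
    \<open>|1 - cnj z * b|^2 \<le> 4\<close>.\<close>
  have "(norm (cnj (F z) + F b))\<^sup>2 * ((1 - (norm z)\<^sup>2) * (1 - (norm b)\<^sup>2)) \<le> (norm (1 - cnj z * b))\<^sup>2 * (4 * Re (F z) * Re (F b))"
    by (rule Schwarz_Pick_into_halfplane) (use Fpos z b in \<open>auto simp: F_def[abs_def] intro!: holomorphic_intros f_hol\<close>)
  moreover have "(R * exp s)\<^sup>2 \<le> (norm (cnj (F z) + F b))\<^sup>2"
  proof (rule power_mono)
    have "R * exp s \<le> Re (cnj (F z) + F b)" using R by (simp add: Fb R_def mult.commute)
    then show "R * exp s \<le> norm (cnj (F z) + F b)" using complex_Re_le_cmod order_trans by blast
  qed (use R in simp)
  moreover have "(norm (1 - cnj z * b))\<^sup>2 \<le> 2\<^sup>2"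
  proof (rule power_mono)
    have "norm (cnj z * b) \<le> 1" using z b by (auto simp: norm_mult intro!: mult_le_one)
    then show "norm (1 - cnj z * b) \<le> 2" using norm_triangle_ineq4[of 1 "cnj z * b"] by simp
  qed simp
  moreover have "0 \<le> 4 * Re (F z) * Re (F b)" using Fpos z b by (simp add: less_imp_le)
  ultimately have "(R * exp s)\<^sup>2 * ((1 - (norm z)\<^sup>2) * (1 - (norm b)\<^sup>2)) \<le> 2\<^sup>2 * (4 * Re (F z) * Re (F b))"
    using pz by (meson mult_right_mono order_trans mult_nonneg_nonneg less_imp_le)
  also have "2\<^sup>2 * (4 * Re (F z) * Re (F b)) = 16 * R\<^sup>2 * exp s" by (simp add: Fb R_def power2_eq_square)
  finally have "(R\<^sup>2 * exp s) * (exp s * ((1 - (norm z)\<^sup>2) * (1 - (norm b)\<^sup>2))) \<le> (R\<^sup>2 * exp s) * 16"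
    by (simp add: power2_eq_square mult_ac)
  then have "exp s * ((1 - (norm z)\<^sup>2) * (1 - (norm b)\<^sup>2)) \<le> 16"
    using R by (subst (asm) mult_le_cancel_left_pos) auto
  then show ?thesis using pz unfolding b_def[symmetric] by (simp add: exp_minus field_simps)
qed

text \<open>Each height enters \<open>V\<close> at some integer abscissa, together with nearby
  heights since \<open>V\<close> is open; compactness leaves finitely many abscissae. For the full
  open strip this can fail, hence the margin below \<open>pi / 2\<close>.\<close>

lemma contains_half_strip:
  assumes "\<theta> < pi / 2"
  obtains R where "\<And>w. Re w \<ge> R \<Longrightarrow> \<bar>Im w\<bar> \<le> \<theta> \<Longrightarrow> w \<in> V"
proof -
  define Y where "Y n = {y. Complex (real n) y \<in> V}" for n
  have "open (Y n)" for n
  proof -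
    have "open ((\<lambda>y. Complex (real n) y) -` V)"
      unfolding Complex_eq by (intro open_vimage open_V continuous_intros)
    then show ?thesis by (simp add: Y_def vimage_def)
  qed
  moreover have "{- \<theta>..\<theta>} \<subseteq> (\<Union>n\<in>UNIV. Y n)"
  proof
    fix y assume "y \<in> {- \<theta>..\<theta>}"
    then have "\<bar>y\<bar> < pi / 2" using assms by auto
    then obtain x where x: "Complex x y \<in> V" using fill by blast
    obtain n where "x \<le> real n" using real_arch_simple by blast
    then have "Complex (real n) y \<in> V" using shift[OF x, of "real n - x"] by (simp add: Complex_eq add.commute)
    then show "y \<in> (\<Union>n\<in>UNIV. Y n)" by (auto simp: Y_def)
  qed
  ultimately obtain N where N: "finite N" "{- \<theta>..\<theta>} \<subseteq> (\<Union>n\<in>N. Y n)"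
    using compactE_image[of "{- \<theta>..\<theta>}" UNIV Y] by auto
  \<comment> \<open>Inserting 0 keeps \<open>Max\<close> meaningful when \<open>N\<close> is empty,
    which may happen for negative \<open>\<theta>\<close>.\<close>
  have "w \<in> V" if w: "Re w \<ge> real (Max (insert 0 N))" "\<bar>Im w\<bar> \<le> \<theta>" for w
  proof -
    obtain n where n: "n \<in> N" "Complex (real n) (Im w) \<in> V" 
    proof -
      have "Im w \<in> (\<Union>n\<in>N. Y n)" using N(2) w(2) by (intro subsetD[OF N(2)]) auto
      then show ?thesis using that by (auto simp: Y_def)
    qed
    then have "real n \<le> Re w" using w(1) N(1) by (meson Max_ge finite_insert insertCI of_nat_le_iff order_trans)
    moreover have "Complex (real n) (Im w) + of_real (Re w - real n) = w" by (simp add: complex_eq_iff)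
    ultimately show ?thesis using shift[OF n(2), of "Re w - real n"] by simp
  qed
  then show ?thesis by (rule that)
qed

text \<open>For \<open>p < 1\<close> the map \<open>\<zeta> \<mapsto> R + p Ln (1 + \<zeta>)\<close> sends the right half-plane into a half-strip
  strictly narrower than the strip, so into \<open>V\<close> when \<open>R\<close> is large.\<close>

lemma orbit_lower_bound:
  assumes p: "0 < p" "p < 1"
  obtains a c where "a \<in> \<bbbD>" "c > 0" "\<And>s. s \<ge> 0 \<Longrightarrow> c * exp (- (s / p)) \<le> 1 - (norm (\<psi> s a))\<^sup>2"
proof -
  obtain R where R: "\<And>w. Re w \<ge> R \<Longrightarrow> \<bar>Im w\<bar> \<le> p * pi / 2 \<Longrightarrow> w \<in> V"
    using contains_half_strip[of "p * pi / 2"] p by auto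
  \<comment> \<open>The summand 1 keeps the argument of \<open>Ln\<close> at modulus at least 1, so
    \<open>Re (m \<zeta>)\<close> never drops below \<open>R\<close>.\<close>
  define m where "m \<zeta> = of_real R + of_real p * Ln (1 + \<zeta>)" for \<zeta>
  have mV: "m \<zeta> \<in> V" if "Re \<zeta> > 0" for \<zeta>
  proof (rule R)
    have nz: "1 + \<zeta> \<noteq> 0" using that by (auto simp: complex_eq_iff)
    have "1 \<le> norm (1 + \<zeta>)" using complex_Re_le_cmod[of "1 + \<zeta>"] that by simp
    then show "R \<le> Re (m \<zeta>)" using p nz by (simp add: m_def)
    have "\<bar>Im (Ln (1 + \<zeta>))\<bar> < pi / 2" using that Re_Ln_pos_lt[OF nz] by simp
    then have "p * \<bar>Im (Ln (1 + \<zeta>))\<bar> \<le> p * (pi / 2)" using p by (intro mult_left_mono) auto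
    then show "\<bar>Im (m \<zeta>)\<bar> \<le> p * pi / 2" using p by (simp add: m_def abs_mult)
  qed
  have "m holomorphic_on {\<zeta>. Re \<zeta> > 0}"
    unfolding m_def by (intro holomorphic_intros) (auto simp: complex_nonpos_Reals_iff)
  then have hol: "(g \<circ> m) holomorphic_on {\<zeta>. Re \<zeta> > 0}"
    by (rule holomorphic_on_compose_gen[OF _ g_hol]) (use mV in auto)
  define a where "a = g (m 1)"
  have a: "a \<in> \<bbbD>" using g_in mV by (simp add: a_def)
  have "(1 - norm a)\<^sup>2 * exp (- (s / p)) \<le> 1 - (norm (\<psi> s a))\<^sup>2" if s: "s \<ge> 0" for s
  proof -
    define E where "E = exp (s / p)"
    have E: "E \<ge> 1" using s p by (simp add: E_def)
    define b where "b = \<psi> s a"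
    have b: "b \<in> \<bbbD>" using \<psi>_in[OF s a] by (simp add: b_def)
    \<comment> \<open>The point \<open>2 * E - 1\<close> is chosen so that
      \<open>1 + (2 * E - 1)\<close> is \<open>E\<close> times \<open>1 + 1\<close>; then
      \<open>m\<close> sends it to \<open>m 1 + s\<close>, the orbit of \<open>a\<close> in
      \<open>V\<close> at time \<open>s\<close>.\<close>
    have Ln: "Ln (1 + of_real (2 * E - 1)) = of_real (ln 2 + s / p)"
    proof -
      have "(1::complex) + of_real (2 * E - 1) = of_real (2 * E)" by simp
      then show ?thesis using E by (simp only: Ln_of_real) (simp add: E_def ln_mult)
    qed
    have Ln2: "Ln (1 + 1) = of_real (ln 2)" using Ln_of_real[of 2] by simp
    have "m (of_real (2 * E - 1)) = m 1 + of_real s"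
      unfolding m_def Ln Ln2 using p by (simp add: algebra_simps)
    then have bm: "b = (g \<circ> m) (of_real (2 * E - 1))"
      using fg[OF mV, of 1] by (simp add: b_def \<psi>_def a_def)
    have "(norm (1 - cnj a * b))\<^sup>2 * (4 * Re 1 * Re (of_real (2 * E - 1)))
       \<le> (norm (cnj 1 + of_real (2 * E - 1)))\<^sup>2 * ((1 - (norm a)\<^sup>2) * (1 - (norm b)\<^sup>2))"
      using Schwarz_Pick_from_halfplane[OF hol, of 1 "of_real (2 * E - 1)"] mV g_in E
      unfolding bm[symmetric] by (simp add: a_def)
    moreover have "(norm (cnj 1 + of_real (2 * E - 1)))\<^sup>2 = 4 * E\<^sup>2"
    proof -
      have "cnj 1 + of_real (2 * E - 1) = complex_of_real (2 * E)" by simp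
      then show ?thesis by (simp only: norm_of_real) (simp add: power_mult_distrib)
    qed
    ultimately have "(norm (1 - cnj a * b))\<^sup>2 * (2 * E - 1) \<le> E\<^sup>2 * ((1 - (norm a)\<^sup>2) * (1 - (norm b)\<^sup>2))"
      by (simp add: algebra_simps)
    moreover have "(1 - norm a)\<^sup>2 * E \<le> (norm (1 - cnj a * b))\<^sup>2 * (2 * E - 1)"
    proof (intro mult_mono power_mono)
      have "norm (cnj a * b) \<le> norm a * 1" unfolding norm_mult complex_mod_cnj using b by (intro mult_left_mono) auto
      then show "1 - norm a \<le> norm (1 - cnj a * b)" using norm_triangle_ineq2[of 1 "cnj a * b"] by simp
    qed (use a E in auto)
    moreover have "E\<^sup>2 * ((1 - (norm a)\<^sup>2) * (1 - (norm b)\<^sup>2)) \<le> E\<^sup>2 * (1 * (1 - (norm b)\<^sup>2))"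
      using one_minus_norm_sq_pos[OF b] by (intro mult_left_mono mult_right_mono) auto
    ultimately have "E * (1 - norm a)\<^sup>2 \<le> E * (E * (1 - (norm b)\<^sup>2))" by (simp add: power2_eq_square mult_ac)
    then have "(1 - norm a)\<^sup>2 \<le> E * (1 - (norm b)\<^sup>2)" using E by simp
    then show ?thesis using E by (simp add: b_def[symmetric] exp_minus E_def[symmetric] field_simps)
  qed
  moreover have "(1 - norm a)\<^sup>2 > 0" using a by simp
  ultimately show ?thesis using that a by blast
qed

lemma one_minus_norm_orbit_tendsto:
  assumes "z \<in> \<bbbD>"
  shows "((\<lambda>s. 1 - (norm (\<psi> s z))\<^sup>2) \<longlongrightarrow> 0) at_top"
proof (rule tendsto_sandwich[OF _ _ tendsto_const])
  have "((\<lambda>s::real. exp (- s)) \<longlongrightarrow> 0) at_top"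
    by (rule filterlim_compose[OF exp_at_bot filterlim_uminus_at_bot_at_top])
  then have "((\<lambda>s. 16 / (1 - (norm z)\<^sup>2) * exp (- s)) \<longlongrightarrow> 16 / (1 - (norm z)\<^sup>2) * 0) at_top"
    by (intro tendsto_intros)
  then show "((\<lambda>s. 16 / (1 - (norm z)\<^sup>2) * exp (- s)) \<longlongrightarrow> 0) at_top" by simp
  show "\<forall>\<^sub>F s in at_top. 1 - (norm (\<psi> s z))\<^sup>2 \<le> 16 / (1 - (norm z)\<^sup>2) * exp (- s)"
    using eventually_ge_at_top[of 0] by eventually_elim (rule orbit_upper_bound[OF assms])
  show "\<forall>\<^sub>F s in at_top. 0 \<le> 1 - (norm (\<psi> s z))\<^sup>2"
    using eventually_ge_at_top[of 0] by eventually_elim (use one_minus_norm_sq_pos \<psi>_in assms in \<open>blast intro: less_imp_le\<close>)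
qed

text \<open>At times \<open>n * t\<close> the contraction bounds \<open>horo\<close> by a multiple
  of \<open>r ^ n\<close>, while the slow orbit keeps it above a multiple of
  \<open>exp (- (n * t / p))\<close>. Letting \<open>n\<close> grow removes the constants, although
  \<open>a\<close> and \<open>c\<close> depend on \<open>p\<close>; letting \<open>p\<close> tend to
  1 removes the loss in the exponent.\<close>

lemma horo_contraction_rate:
  assumes \<tau>: "norm \<tau> = 1" and t: "t \<ge> 0" and r: "r \<ge> 0"
    and contr: "\<And>z. z \<in> \<bbbD> \<Longrightarrow> horo \<tau> (\<psi> t z) \<le> r * horo \<tau> z"
  shows "exp (- t) \<le> r"
proof (rule field_le_epsilon)
  have rate: "exp (- (t / p)) \<le> r" if p: "0 < p" "p < 1" for p
  proof -
    obtain a c where a: "a \<in> \<bbbD>" "c > 0" "\<And>s. s \<ge> 0 \<Longrightarrow> c * exp (- (s / p)) \<le> 1 - (norm (\<psi> s a))\<^sup>2"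
      using orbit_lower_bound[OF p] by blast
    have iter: "horo \<tau> (\<psi> (real n * t) a) \<le> r ^ n * horo \<tau> a" for n
    proof (induction n)
      case 0 then show ?case using gf[OF a(1)] by (simp add: \<psi>_def)
    next
      case (Suc n)
      have "horo \<tau> (\<psi> (real (Suc n) * t) a) = horo \<tau> (\<psi> t (\<psi> (real n * t) a))"
        using \<psi>_add[of t "real n * t" a] t a by (simp add: algebra_simps)
      also have "\<dots> \<le> r * horo \<tau> (\<psi> (real n * t) a)" using t a by (intro contr \<psi>_in) auto
      also have "\<dots> \<le> r * (r ^ n * horo \<tau> a)" by (intro mult_left_mono Suc r)
      finally show ?case by simp
    qed
    have "c \<le> (4 * horo \<tau> a) * (r * exp (t / p)) ^ n" for n
    proof -
      have "c * exp (- (real n * t / p)) \<le> 1 - (norm (\<psi> (real n * t) a))\<^sup>2" using t by (intro a) auto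
      also have "\<dots> \<le> 4 * horo \<tau> (\<psi> (real n * t) a)"
        using horo_lower_bound[OF \<tau> \<psi>_in[of "real n * t" a]] t a by simp
      also have "\<dots> \<le> 4 * (r ^ n * horo \<tau> a)" using iter by simp
      finally have "c * exp (- (real n * t / p)) * exp (real n * t / p) \<le> 4 * (r ^ n * horo \<tau> a) * exp (real n * t / p)"
        by (intro mult_right_mono) auto
      also have "c * exp (- (real n * t / p)) * exp (real n * t / p) = c"
        unfolding mult.assoc mult_exp_exp by simp
      also have "exp (real n * t / p) = exp (t / p) ^ n" using exp_of_nat_mult[of n "t / p"] by simp
      finally show ?thesis by (simp only: power_mult_distrib mult_ac)
    qed
    then have "r * exp (t / p) \<ge> 1" using a(2) r by (intro geometric_bound_ge_1[of c]) auto
    then show ?thesis by (simp add: exp_minus field_simps)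
  qed
  fix e :: real assume e: "e > 0"
  have "((\<lambda>p. exp (- (t / p))) \<longlongrightarrow> exp (- (t / 1))) (at_left 1)" by (intro tendsto_intros) auto
  moreover have "\<forall>\<^sub>F p in at_left 1. exp (- (t / p)) \<le> r"
    using eventually_at_left_real[of 0 1] by (auto elim!: eventually_mono intro: rate)
  ultimately have "exp (- (t / 1)) \<le> r" by (rule tendsto_upperbound) simp
  then show "exp (- t) \<le> r + e" using e by simp
qed

theorem hyperbolic_\<psi>: "hyperbolic_semigroup \<psi>"
proof -
  note sg = holomorphic_semigroup_\<psi>
  obtain \<tau> where \<tau>: "norm \<tau> = 1" and horo_dec: "\<And>t z. t \<ge> 0 \<Longrightarrow> z \<in> \<bbbD> \<Longrightarrow> horo \<tau> (\<psi> t z) \<le> horo \<tau> z"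
    using semigroup_Wolff[OF sg not_elliptic_\<psi>] by blast
  have lim: "((\<lambda>t. \<psi> t z) \<longlongrightarrow> \<tau>) at_top" if z: "z \<in> \<bbbD>" for z
  proof -
    have "\<forall>\<^sub>F t in at_top. \<psi> t z \<in> \<bbbD> \<and> horo \<tau> (\<psi> t z) \<le> horo \<tau> z"
      using eventually_ge_at_top[of 0] by eventually_elim (use \<psi>_in horo_dec z in blast)
    then show ?thesis using one_minus_norm_orbit_tendsto[OF z] by (rule tendsto_if_horo_bounded)
  qed
  have DW: "denjoy_wolff_point \<psi> \<tau>"
    using \<tau> lim by (auto simp: denjoy_wolff_point_def frontier_def)
  define q where "q t z = (1 - norm (\<psi> t z)) / (1 - norm z)" for t z
  \<comment> \<open>Otherwise some \<open>a n\<close> tending to \<open>\<tau>\<close> have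
    quotients at most \<open>r < exp (- t)\<close>. Their images cluster at a boundary point
    \<open>y\<close>, and Julia's lemma sends horodiscs at \<open>\<tau>\<close> into horodiscs at
    \<open>y\<close> with factor \<open>r\<close>.\<close>
  have lower: "ereal (exp (- t)) \<le> Liminf (at \<tau> within \<bbbD>) (\<lambda>z. ereal (q t z))" if t: "t \<ge> 0" for t
    unfolding le_Liminf_iff
  proof (intro allI impI, rule ccontr)
    fix y assume y: "y < ereal (exp (- t))" and "\<not> (\<forall>\<^sub>F z in at \<tau> within \<bbbD>. y < ereal (q t z))"
    then have fr: "\<exists>\<^sub>F z in at \<tau> within \<bbbD>. ereal (q t z) \<le> y" by (simp add: frequently_def not_le)
    obtain r where r: "y < ereal r" "r < exp (- t)" using ereal_dense2[OF y] by auto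
    have "\<exists>z\<in>\<bbbD>. dist z \<tau> < 1 / real (Suc n) \<and> q t z \<le> r" for n
    proof -
      have "\<exists>z\<in>\<bbbD>. z \<noteq> \<tau> \<and> dist z \<tau> < 1 / real (Suc n) \<and> ereal (q t z) \<le> y"
        using fr unfolding frequently_at by (metis of_nat_0_less_iff zero_less_Suc zero_less_divide_1_iff)
      then show ?thesis using r(1) by (metis ereal_less_eq(3) less_imp_le order_trans)
    qed
    then obtain a where a: "\<And>n. a n \<in> \<bbbD>" "\<And>n. dist (a n) \<tau> < 1 / real (Suc n)" "\<And>n. q t (a n) \<le> r" by metis
    have alim: "a \<longlonglongrightarrow> \<tau>"
    proof (rule metric_tendsto_imp_tendsto[OF LIMSEQ_inverse_real_of_nat])
      show "\<forall>\<^sub>F n in sequentially. dist (a n) \<tau> \<le> dist (inverse (real (Suc n))) 0"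
        using a(2) by (intro always_eventually) (auto simp: dist_norm less_imp_le divide_inverse)
    qed
    have qa: "1 - norm (\<psi> t (a n)) \<le> r * (1 - norm (a n))" for n
      using a(3)[of n] a(1)[of n] by (simp add: q_def pos_divide_le_eq)
    have \<psi>a: "\<psi> t (a n) \<in> \<bbbD>" for n using \<psi>_in[OF t a(1)] .
    then have "\<psi> t (a n) \<in> cball 0 1" for n by (meson ball_subset_cball subsetD)
    then obtain y \<sigma> where \<sigma>: "strict_mono \<sigma>" and ylim: "((\<lambda>n. \<psi> t (a n)) \<circ> \<sigma>) \<longlonglongrightarrow> y"
      using compact_cball[of "0::complex" 1] unfolding compact_def by metis
    have a\<sigma>: "(a \<circ> \<sigma>) \<longlonglongrightarrow> \<tau>" using LIMSEQ_subseq_LIMSEQ[OF alim \<sigma>] .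
    have nlim: "(\<lambda>n. norm ((a \<circ> \<sigma>) n)) \<longlonglongrightarrow> 1" using tendsto_norm[OF a\<sigma>] by (simp add: \<tau>)
    have r0: "r > 0"
    proof -
      have "0 < r * (1 - norm (a 0))" using qa[of 0] \<psi>a[of 0] by simp
      then show ?thesis using a(1)[of 0] by (simp add: zero_less_mult_iff)
    qed
    have "norm y = 1"
    proof -
      have "(\<lambda>n. norm (((\<lambda>n. \<psi> t (a n)) \<circ> \<sigma>) n)) \<longlonglongrightarrow> 1"
      proof (rule tendsto_sandwich[OF _ _ _ tendsto_const])
        have "(\<lambda>n. 1 - r * (1 - norm ((a \<circ> \<sigma>) n))) \<longlonglongrightarrow> 1 - r * (1 - 1)" by (intro tendsto_intros nlim)
        then show "(\<lambda>n. 1 - r * (1 - norm ((a \<circ> \<sigma>) n))) \<longlonglongrightarrow> 1" by simp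
        show "\<forall>\<^sub>F n in sequentially. 1 - r * (1 - norm ((a \<circ> \<sigma>) n)) \<le> norm (((\<lambda>n. \<psi> t (a n)) \<circ> \<sigma>) n)"
          using qa by (auto simp: algebra_simps)
        show "\<forall>\<^sub>F n in sequentially. norm (((\<lambda>n. \<psi> t (a n)) \<circ> \<sigma>) n) \<le> 1"
          using \<psi>a by (auto simp: less_imp_le)
      qed
      then show ?thesis using tendsto_norm[OF ylim] LIMSEQ_unique by blast
    qed
    have contr: "horo y (\<psi> t z) \<le> r * horo \<tau> z" if z: "z \<in> \<bbbD>" for z
    \<comment> \<open>The factor \<open>2 / (1 + |a n|)\<close> passes from quotients of
      \<open>1 - |w|\<close> to quotients of \<open>1 - |w|^2\<close>; it tends to 1 because
      \<open>a n\<close> tends to the circle.\<close>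
    proof (rule Julia_limit[where f="\<lambda>_. \<psi> t" and a="a \<circ> \<sigma>" and c="\<lambda>n. r * 2 / (1 + norm ((a \<circ> \<sigma>) n))"])
      show "1 - (norm (\<psi> t ((a \<circ> \<sigma>) n)))\<^sup>2 \<le> r * 2 / (1 + norm ((a \<circ> \<sigma>) n)) * (1 - (norm ((a \<circ> \<sigma>) n))\<^sup>2)" for n
      proof -
        let ?A = "norm (a (\<sigma> n))" and ?B = "norm (\<psi> t (a (\<sigma> n)))"
        have B: "?B < 1" using \<psi>a[of "\<sigma> n"] by simp
        have A: "0 < 1 + ?A" by (simp add: add_pos_nonneg)
        have "1 - ?B\<^sup>2 = (1 - ?B) * (1 + ?B)" by (simp add: power2_eq_square algebra_simps)
        also have "\<dots> \<le> (r * (1 - ?A)) * 2"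
          using qa[of "\<sigma> n"] B a(1)[of "\<sigma> n"] r0 by (intro mult_mono) auto
        also have "\<dots> = r * 2 / (1 + ?A) * (1 - ?A\<^sup>2)"
        proof -
          have "1 - ?A\<^sup>2 = (1 + ?A) * (1 - ?A)" by (simp add: power2_eq_square algebra_simps)
          then show ?thesis using A by simp
        qed
        finally show ?thesis by simp
      qed
      have "(\<lambda>n. r * 2 / (1 + norm ((a \<circ> \<sigma>) n))) \<longlonglongrightarrow> r * 2 / (1 + 1)" by (intro tendsto_intros nlim) auto
      then show "(\<lambda>n. r * 2 / (1 + norm ((a \<circ> \<sigma>) n))) \<longlonglongrightarrow> r" by simp
      show "(\<lambda>n. \<psi> t ((a \<circ> \<sigma>) n)) \<longlonglongrightarrow> y" using ylim by (simp add: o_def)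
      show "\<psi> t holomorphic_on \<bbbD>" using semigroupD(1)[OF sg t] .
      show "\<psi> t ` \<bbbD> \<subseteq> \<bbbD>" "\<psi> t z \<in> \<bbbD>" using \<psi>_in[OF t] z by auto
    qed (use a(1) a\<sigma> \<tau> \<open>norm y = 1\<close> z in auto)
    \<comment> \<open>To iterate, the contraction must be centred at one point. By commutativity the
      orbit of \<open>\<psi> t 0\<close> is the image under \<open>\<psi> t\<close> of the orbit of
      0, hence stays in a horodisc at \<open>y\<close> and converges to \<open>y\<close>; but it
      also converges to \<open>\<tau>\<close>.\<close>
    have "y = \<tau>"
    proof (rule tendsto_unique)
      have t0: "\<psi> t 0 \<in> \<bbbD>" by (intro \<psi>_in t) auto
      have "\<forall>\<^sub>F s in at_top. \<psi> s (\<psi> t 0) \<in> \<bbbD> \<and> horo y (\<psi> s (\<psi> t 0)) \<le> r * horo \<tau> 0"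
        using eventually_ge_at_top[of 0]
      proof eventually_elim
        case (elim s)
        have "\<psi> s (\<psi> t 0) = \<psi> t (\<psi> s 0)"
          using \<psi>_add[of s t 0] \<psi>_add[of t s 0] t elim by (simp add: add.commute)
        moreover have "horo y (\<psi> t (\<psi> s 0)) \<le> r * horo \<tau> (\<psi> s 0)" using elim by (intro contr \<psi>_in) auto
        moreover have "r * horo \<tau> (\<psi> s 0) \<le> r * horo \<tau> 0" using r0 elim by (intro mult_left_mono horo_dec) auto
        ultimately show ?case using \<psi>_in[OF elim t0] by simp
      qed
      then show "((\<lambda>s. \<psi> s (\<psi> t 0)) \<longlongrightarrow> y) at_top"
        using one_minus_norm_orbit_tendsto[OF t0] by (rule tendsto_if_horo_bounded)
      show "((\<lambda>s. \<psi> s (\<psi> t 0)) \<longlongrightarrow> \<tau>) at_top" by (intro lim \<psi>_in t) auto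
    qed simp
    then have "exp (- t) \<le> r"
      using contr r0 by (intro horo_contraction_rate[OF \<tau> t]) auto
    then show False using r(2) by simp
  qed
  \<comment> \<open>The orbit of 0 is one approach to \<open>\<tau>\<close>. A lower limit above
    \<open>r > exp (- t)\<close> would eventually keep at least the fraction \<open>r\<close> of its
    distance to the circle in each time step \<open>t\<close>, against
    \<open>orbit_upper_bound\<close>.\<close>
  have upper: "Liminf (at \<tau> within \<bbbD>) (\<lambda>z. ereal (q t z)) \<le> ereal (exp (- t))" if t: "t \<ge> 0" for t
  proof (rule ccontr)
    assume "\<not> ?thesis"
    then have "ereal (exp (- t)) < Liminf (at \<tau> within \<bbbD>) (\<lambda>z. ereal (q t z))" by simp
    then obtain r where r: "exp (- t) < r" "ereal r < Liminf (at \<tau> within \<bbbD>) (\<lambda>z. ereal (q t z))"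
      using ereal_dense2 by (metis ereal_less(1) less_ereal.simps(1))
    have "filterlim (\<lambda>s. \<psi> s 0) (at \<tau> within \<bbbD>) at_top"
      unfolding filterlim_at
    proof
      show "\<forall>\<^sub>F s in at_top. \<psi> s 0 \<in> \<bbbD> \<and> \<psi> s 0 \<noteq> \<tau>"
        using eventually_ge_at_top[of 0]
      proof eventually_elim
        case (elim s)
        then show ?case using \<psi>_in[of s 0] \<tau> by auto
      qed
    qed (use lim[of 0] in simp)
    then have "\<forall>\<^sub>F s in at_top. ereal r < ereal (q t (\<psi> s 0))"
      using less_LiminfD[OF r(2)] by (rule eventually_compose_filterlim[rotated])
    then obtain S where S: "S \<ge> 0" "\<And>s. s \<ge> S \<Longrightarrow> r < q t (\<psi> s 0)"
      unfolding eventually_at_top_linorder by (metis less_ereal.simps(1) max.bounded_iff max.cobounded1)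
    define d where "d s = 1 - norm (\<psi> s 0)" for s
    have step: "r * d s \<le> d (t + s)" if "s \<ge> S" for s
      using S(2)[OF that] \<psi>_in[of s 0] \<psi>_add[of t s 0] S(1) t that by (simp add: q_def d_def pos_less_divide_eq)
    have r0: "r > 0" using r(1) exp_gt_zero[of "- t"] by linarith
    have "r ^ n * d S \<le> d (real n * t + S)" for n
    proof (induction n)
      case (Suc n)
      have "r ^ Suc n * d S \<le> r * d (real n * t + S)" using Suc r0 by (simp add: mult.assoc)
      also have "\<dots> \<le> d (t + (real n * t + S))" using t by (intro step) auto
      finally show ?case by (simp add: algebra_simps)
    qed simp
    moreover have "d (real n * t + S) \<le> 16 * exp (- (real n * t + S))" for n
    proof -
      have "norm (\<psi> (real n * t + S) 0) < 1" using \<psi>_in[of "real n * t + S" 0] t S(1) by simp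
      then have "(norm (\<psi> (real n * t + S) 0))\<^sup>2 \<le> norm (\<psi> (real n * t + S) 0)"
        unfolding power2_eq_square by (intro mult_left_le_one_le) auto
      then show ?thesis using orbit_upper_bound[of 0 "real n * t + S"] t S(1) by (simp add: d_def)
    qed
    ultimately have *: "r ^ n * d S \<le> 16 * exp (- (real n * t + S))" for n by (meson order_trans)
    have "d S \<le> (16 * exp (- S)) * (exp (- t) / r) ^ n" for n
    proof -
      have "exp (- (real n * t + S)) = exp (- S) * exp (- t) ^ n"
        by (simp add: algebra_simps flip: exp_of_nat_mult exp_add)
      then show ?thesis using *[of n] r0 by (simp add: field_simps power_divide)
    qed
    then have "exp (- t) / r \<ge> 1"
      using \<psi>_in[OF S(1), of 0] r0 by (intro geometric_bound_ge_1[of "d S"]) (auto simp: d_def)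
    then show False using r(1) r0 by simp
  qed
  have "dilation \<psi> (- 1)"
    unfolding dilation_def using DW lower upper by (auto intro!: exI[of _ \<tau>] antisym simp: q_def)
  then show ?thesis
    unfolding hyperbolic_semigroup_def using sg not_elliptic_\<psi> by (intro conjI exI[of _ "-1"]) auto
qed

end

subsection \<open>Conjugation to a hyperbolic semigroup\<close>

text \<open>\<open>arctan\<close> makes the range of \<open>Im\<close> bounded; an affine map then normalises it to
  \<open>(-pi/2, pi/2)\<close>, so that the strip becomes the smallest one containing the image.\<close>

lemma vertical_compression:
  fixes U :: "complex set"
  assumes U: "open U" "connected U" "U \<noteq> {}"
  obtains q :: "real \<Rightarrow> real" where "continuous_on UNIV q" "inj q" "q ` Im ` U = {- pi / 2<..<pi / 2}"
proof -
  define J where "J = arctan ` Im ` U"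
  have J: "connected J" "J \<noteq> {}"
    unfolding J_def using U by (auto intro!: connected_continuous_image continuous_intros)
  have bd: "bdd_above J" "bdd_below J"
    unfolding J_def using arctan_bounded by (auto intro!: bdd_aboveI[of _ "pi/2"] bdd_belowI[of _ "- (pi/2)"] simp: less_imp_le)
  \<comment> \<open>Openness of \<open>U\<close> gives room above and below every point, so
    \<open>J\<close> contains neither its infimum nor its supremum; connectedness fills the gap
    between them.\<close>
  have nbr: "\<exists>e>0. \<forall>y. \<bar>y - Im w\<bar> < e \<longrightarrow> arctan y \<in> J" if "w \<in> U" for w
  proof -
    obtain e where e: "e > 0" "ball w e \<subseteq> U" using U(1) \<open>w \<in> U\<close> open_contains_ball by blast
    have "arctan y \<in> J" if "\<bar>y - Im w\<bar> < e" for y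
    proof -
      have "w - Complex (Re w) y = Complex 0 (Im w - y)" by (simp add: complex_eq_iff)
      then have "Complex (Re w) y \<in> ball w e" using that by (simp add: dist_norm cmod_def)
      then have "Complex (Re w) y \<in> U" using e(2) by blast
      then show ?thesis unfolding J_def by (metis complex.sel(2) imageI)
    qed
    then show ?thesis using e(1) by blast
  qed
  define A where "A = Inf J"
  define B where "B = Sup J"
  have J_eq: "J = {A<..<B}"
  proof (intro subset_antisym subsetI)
    fix v assume "v \<in> J"
    then obtain w where w: "w \<in> U" "v = arctan (Im w)" by (auto simp: J_def)
    obtain e where e: "e > 0" "\<And>y. \<bar>y - Im w\<bar> < e \<Longrightarrow> arctan y \<in> J" using nbr[OF w(1)] by blast
    have "A \<le> arctan (Im w - e / 2)" "arctan (Im w + e / 2) \<le> B"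
      unfolding A_def B_def using e by (auto intro!: cInf_lower cSup_upper bd)
    moreover have "arctan (Im w - e / 2) < v" "v < arctan (Im w + e / 2)" using w e by (auto simp: arctan_less_iff)
    ultimately show "v \<in> {A<..<B}" by auto
  next
    fix v assume v: "v \<in> {A<..<B}"
    obtain a where "a \<in> J" "a < v" using v cInf_lessD[OF J(2), of v] by (auto simp: A_def)
    moreover obtain b where "b \<in> J" "v < b" using v less_cSupD[OF J(2), of v] by (auto simp: B_def)
    ultimately show "v \<in> J" using connected_contains_Icc[OF J(1), of a b] by auto
  qed
  have AB: "A < B" using J(2) J_eq by auto
  define l where "l v = (v - A) / (B - A) * pi - pi / 2" for v
  have "l ` {A<..<B} = {- pi / 2<..<pi / 2}"
  proof (intro subset_antisym subsetI)
    fix y assume "y \<in> l ` {A<..<B}"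
    then obtain v where v: "A < v" "v < B" "y = l v" by auto
    define u where "u = (v - A) / (B - A)"
    have "0 < u" "u < 1" using v AB by (auto simp: u_def divide_simps)
    then have "0 < u * pi" "u * pi < pi" by simp_all
    then show "y \<in> {- pi / 2<..<pi / 2}" using v(3) by (simp add: l_def flip: u_def)
  next
    fix y assume y: "y \<in> {- pi / 2<..<pi / 2}"
    define u where "u = (y + pi / 2) / pi"
    have u: "0 < u" "u < 1" using y by (auto simp: u_def divide_simps)
    have "l (A + u * (B - A)) = u * pi - pi / 2" using AB by (simp add: l_def)
    also have "\<dots> = y" by (simp add: u_def)
    finally have "l (A + u * (B - A)) = y" .
    moreover have "0 < u * (B - A)" "u * (B - A) < B - A" using u AB by simp_all
    then have "A + u * (B - A) \<in> {A<..<B}" by (simp only: greaterThanLessThan_iff) linarith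
    ultimately show "y \<in> l ` {A<..<B}" by (metis imageI)
  qed
  then have "(\<lambda>y. l (arctan y)) ` Im ` U = {- pi / 2<..<pi / 2}"
    by (simp only: J_eq[symmetric]) (simp only: J_def image_image)
  moreover have "continuous_on UNIV (\<lambda>y. l (arctan y))"
    unfolding l_def using AB by (intro continuous_intros) auto
  moreover have "inj (\<lambda>y. l (arctan y))"
    using AB by (auto simp: inj_def l_def arctan_eq_iff)
  ultimately show ?thesis using that by blast
qed

theorem corollary3p6:
  fixes \<phi> :: "real \<Rightarrow> complex \<Rightarrow> complex"
  assumes "holomorphic_semigroup \<phi>" and "\<not> elliptic \<phi>"
  shows "\<exists>\<psi>. hyperbolic_semigroup \<psi> \<and> topologically_conjugated \<phi> \<psi>"
proof -
  obtain h where h: "h holomorphic_on \<bbbD>" "inj_on h \<bbbD>"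
    "\<And>t z. t \<ge> 0 \<Longrightarrow> z \<in> \<bbbD> \<Longrightarrow> h (\<phi> t z) = h z + of_real t"
    using Koenigs_function[OF assms] by blast
  have conth: "continuous_on \<bbbD> h" using h(1) by (rule holomorphic_on_imp_continuous_on)
  have "open (h ` \<bbbD>)" by (rule open_mapping_thm3[OF h(1) open_ball h(2)])
  moreover have "connected (h ` \<bbbD>)" using conth by (intro connected_continuous_image) auto
  ultimately obtain q :: "real \<Rightarrow> real" where q: "continuous_on UNIV q" "inj q" "q ` Im ` h ` \<bbbD> = {- pi / 2<..<pi / 2}"
    using vertical_compression[of "h ` \<bbbD>"] by (metis ball_eq_empty image_is_empty not_one_le_zero)
  define k where "k z = Complex (Re (h z)) (q (Im (h z)))" for z
  have k_\<phi>: "k (\<phi> t z) = k z + of_real t" if "t \<ge> 0" "z \<in> \<bbbD>" for t z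
    using h(3)[OF that] by (simp add: k_def complex_eq_iff)
  have contk: "continuous_on \<bbbD> k"
    unfolding k_def Complex_eq
    by (intro continuous_intros conth continuous_on_compose2[OF q(1)]) auto
  have injk: "inj_on k \<bbbD>"
  proof (rule inj_onI)
    fix x y assume xy: "x \<in> \<bbbD>" "y \<in> \<bbbD>" "k x = k y"
    then have "h x = h y" using q(2) by (auto simp: k_def complex_eq_iff inj_eq)
    then show "x = y" using h(2) xy by (auto dest: inj_onD)
  qed
  define V where "V = k ` \<bbbD>"
  \<comment> \<open>\<open>k\<close> is not holomorphic, so the open mapping theorem is replaced by
    invariance of domain. Simple connectedness survives the homeomorphism and makes a Riemann map of
    \<open>V\<close> available.\<close>
  have openV: "open V" unfolding V_def by (rule invariance_of_domain[OF contk open_ball injk])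
  obtain k' where k': "homeomorphism \<bbbD> V k k'"
    using invariance_of_domain_homeomorphism[OF open_ball contk _ injk] by (auto simp: V_def)
  have "simply_connected V"
    using homeomorphic_simply_connected[of \<bbbD> V] k' convex_imp_simply_connected[of \<bbbD>] by (auto simp: homeomorphic_def)
  have strip: "\<bar>Im w\<bar> < pi / 2" if w: "w \<in> V" for w
  proof -
    obtain z where "z \<in> \<bbbD>" "w = k z" using w by (auto simp: V_def)
    then have "Im w \<in> q ` Im ` h ` \<bbbD>" by (auto simp: k_def)
    then show ?thesis unfolding q(3) by auto
  qed
  have "V \<noteq> UNIV" using strip[of "Complex 0 pi"] pi_gt_zero by auto
  moreover have "V \<noteq> {}" by (auto simp: V_def)
  ultimately obtain g f where fg_maps: "g holomorphic_on V" "f holomorphic_on \<bbbD>"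
    "\<And>w. w \<in> V \<Longrightarrow> g w \<in> \<bbbD> \<and> f (g w) = w" "\<And>z. z \<in> \<bbbD> \<Longrightarrow> f z \<in> V \<and> g (f z) = z"
    using Riemann_mapping_theorem[of V] openV \<open>simply_connected V\<close> by blast
  interpret strip_model V f g
  proof
    fix w :: complex and t :: real
    assume "w \<in> V" "t \<ge> 0"
    then obtain z where "z \<in> \<bbbD>" "w = k z" by (auto simp: V_def)
    then show "w + of_real t \<in> V"
      using k_\<phi>[OF \<open>t \<ge> 0\<close>] semigroupD(2)[OF assms(1) \<open>t \<ge> 0\<close>] unfolding V_def by (metis imageI)
  next
    fix y :: real assume "\<bar>y\<bar> < pi / 2"
    then have "y \<in> q ` Im ` h ` \<bbbD>" unfolding q(3) by auto
    then obtain z where "z \<in> \<bbbD>" "y = q (Im (h z))" by blast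
    then have "Complex (Re (h z)) y \<in> V" by (auto simp: V_def k_def)
    then show "\<exists>x. Complex x y \<in> V" by blast
  qed (use fg_maps openV strip in auto)
  have "homeomorphism \<bbbD> V f g"
    by (intro homeomorphismI holomorphic_on_imp_continuous_on f_hol g_hol)
      (use f_in g_in fg gf in auto)
  \<comment> \<open>Both semigroups become the same translations of \<open>V\<close>,
    \<open>\<phi>\<close> through \<open>k\<close> and \<open>\<psi>\<close> through
    \<open>f\<close>; the conjugacy identifies these two charts.\<close>
  then have "homeomorphism \<bbbD> \<bbbD> (k' \<circ> f) (g \<circ> k)"
    using homeomorphism_compose homeomorphism_symD[OF k'] by blast
  moreover have "(k' \<circ> f) (\<psi> t ((g \<circ> k) z)) = \<phi> t z" if t: "t \<ge> 0" and z: "z \<in> \<bbbD>" for t z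
  proof -
    have kz: "k z \<in> V" using z by (simp add: V_def)
    have "f (\<psi> t (g (k z))) = k (\<phi> t z)"
      using f_\<psi>[OF t g_in[OF kz]] fg[OF kz] k_\<phi>[OF t z] by simp
    then show ?thesis using homeomorphism_apply1[OF k' semigroupD(2)[OF assms(1) t z]] by simp
  qed
  ultimately have "topologically_conjugated \<phi> \<psi>" unfolding topologically_conjugated_def by blast
  with hyperbolic_\<psi> show ?thesis by blast
qed

end
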